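(* Let $t>0$ and let $\xi$ be a stationary marked random connection model on $\mathbb{R}^d\times\mathbb{M}$ based on a Poisson process with intensity measure $t\,\lambda_d\otimes\mathbb{Q}$. Assume that $\mathbb{M}$ is a partially ordered probability space with partial order $\preceq$ and that $\mathbb{Q}$ is associated. Assume also that $d_\varphi(p,\cdot)$ is monotone (non-decreasing or non-increasing) for all $p\in\mathbb{M}$. Then $\xi$ is irreducible if and only if $$\int d_\varphi(p,q)\,\mathbb{Q}(dq)>0,\qquad\text{for }\mathbb{Q}\text{-a.e. }p\in\mathbb{M}.$$
   Context: Stationary marked random connection model (RCM). $\mathbb{M}$ is a complete separable metric space with a Borel probability measure $\mathbb{Q}$, $\mathbb{X}=\mathbb{R}^d\times\mathbb{M}$ ($d\ge1$), $\lambda_d$ is Lebesgue measure and $\lambda=\lambda_d\otimes\mathbb{Q}$. The connection function $\varphi\colon\mathbb{X}^2\to[0,1]$ is measurable, symmetric, and satisfies $\varphi((x,p),(y,q))=\varphi((0,p),(y-x,q))$; one writes $\varphi(x,p,q):=\varphi((0,p),(x,q))$ and assumes $\iint\varphi(x,p,q)\,dx\,\mathbb{Q}^2(d(p,q))<\infty$. $\eta$ is a Poisson process on $\mathbb{X}$ with intensity measure $t\lambda$, and $\xi$ is the random graph with vertex set $\eta$ in which, given $\eta$, each pair of distinct points $(x,p),(y,q)\in\eta$ is joined by an edge with probability $\varphi((x,p),(y,q))$, independently for different pairs. For $z_1,z_2\in\mathbb{X}$, $\xi^{z_1,z_2}$ is the RCM based on $\eta+\delta_{z_1}+\delta_{z_2}$.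 $\xi$ is irreducible if $\mathbb{P}(z_1\leftrightarrow z_2\text{ in }\xi^{z_1,z_2})>0$ for $\lambda^2$-a.e. $(z_1,z_2)\in\mathbb{X}^2$, where $\leftrightarrow$ denotes connection by a path. $d_\varphi(p,q):=\int_{\mathbb{R}^d}\varphi(x,p,q)\,dx$ for $p,q\in\mathbb{M}$. $\mathbb{M}$ is a partially ordered probability (POP) space if it is equipped with a partial order $\preceq$ such that $\{(p,q):p\preceq q\}$ is a measurable subset of $\mathbb{M}^2$. A function $f$ on $\mathbb{M}$ is non-decreasing if $x\preceq y$ implies $f(x)\le f(y)$ (non-increasing if it implies $f(x)\ge f(y)$). $\mathbb{Q}$ is (positively) associated if $\int fg\,d\mathbb{Q}\ge\int f\,d\mathbb{Q}\int g\,d\mathbb{Q}$ for all non-decreasing measurable $f,g\colon\mathbb{M}\to\mathbb{R}$ for which the integrals make sense.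
   Formalization: The monotonicity assumption is taken with a common direction: either d_φ(p,·) is non-decreasing for all p, or it is non-increasing for all p; if the direction may vary with p, the claim fails (two ordered marks that only connect to their own kind). *)

theory Defs
  imports "HOL-Probability.Probability"
begin

section \<open>Poisson processes\<close>

text \<open>
  A (simple) point process is represented by the random countable set of its points. The number of
  points in a set is \<^typ>\<open>ennreal\<close>-valued, so that infinitely many points are
  distinguished from none (unlike with \<^const>\<open>card\<close>).

  The representation by sets presupposes that the intensity measure \<open>\<mu>\<close> has no atoms: exactly then
  a Poisson process has almost surely no multiple points.
\<close>

definition num_points :: "'x set \<Rightarrow> 'x set \<Rightarrow> ennreal" where
  "num_points V B = emeasure (count_space UNIV) (V \<inter> B)"

definition poisson_process :: "'w measure \<Rightarrow> 'x measure \<Rightarrow> ('w \<Rightarrow> 'x set) \<Rightarrow> bool" where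
  "poisson_process P \<mu> \<eta> \<longleftrightarrow>
     prob_space P \<and>
     (\<forall>\<omega>\<in>space P. countable (\<eta> \<omega>) \<and> \<eta> \<omega> \<subseteq> space \<mu>) \<and>
     (\<forall>B\<in>sets \<mu>. (\<lambda>\<omega>. num_points (\<eta> \<omega>) B) \<in> borel_measurable P) \<and>
     (\<forall>B\<in>sets \<mu>. emeasure \<mu> B < \<infinity> \<longrightarrow>
        (\<forall>k::nat. measure P {\<omega>\<in>space P. num_points (\<eta> \<omega>) B = of_nat k} =
           measure \<mu> B ^ k / fact k * exp (- measure \<mu> B))) \<and>
     (\<forall>B\<in>sets \<mu>. emeasure \<mu> B = \<infinity> \<longrightarrow> (AE \<omega> in P. num_points (\<eta> \<omega>) B = \<infinity>)) \<and>
     (\<forall>(n::nat) B. (\<forall>i<n. B i \<in> sets \<mu>) \<and> disjoint_family_on B {..<n} \<longrightarrow>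
        prob_space.indep_vars P (\<lambda>_. borel) (\<lambda>i \<omega>. num_points (\<eta> \<omega>) (B i)) {..<n})"


section \<open>The random connection model\<close>

text \<open>The space \<open>\<real>\<^sup>d\<close> is an arbitrary Euclidean space \<^typ>\<open>'a::euclidean_space\<close>.\<close>

definition lam :: "'m measure \<Rightarrow> ('a::euclidean_space \<times> 'm) measure" where
  "lam Q = lborel \<Otimes>\<^sub>M Q"

text \<open>\<open>d_phi \<phi> p q\<close> may be infinite for exceptional \<open>p\<close> and \<open>q\<close>, hence the type \<^typ>\<open>ennreal\<close>.\<close>

definition d_phi :: "('a::euclidean_space \<times> 'm \<Rightarrow> 'a \<times> 'm \<Rightarrow> real) \<Rightarrow> 'm \<Rightarrow> 'm \<Rightarrow> ennreal" where
  "d_phi \<phi> p q = (\<integral>\<^sup>+ x. ennreal (\<phi> (0, p) (x, q)) \<partial>lborel)"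

definition connection_function ::
  "'m::polish_space measure \<Rightarrow> ('a::euclidean_space \<times> 'm \<Rightarrow> 'a \<times> 'm \<Rightarrow> real) \<Rightarrow> bool" where
  "connection_function Q \<phi> \<longleftrightarrow>
     (\<forall>z w. 0 \<le> \<phi> z w \<and> \<phi> z w \<le> 1) \<and>
     (\<lambda>(z, w). \<phi> z w) \<in> borel_measurable ((borel \<Otimes>\<^sub>M borel) \<Otimes>\<^sub>M (borel \<Otimes>\<^sub>M borel)) \<and>
     (\<forall>z w. \<phi> z w = \<phi> w z) \<and>
     (\<forall>x p y q. \<phi> (x, p) (y, q) = \<phi> (0, p) (y - x, q)) \<and>
     (\<integral>\<^sup>+ (p, q). (\<integral>\<^sup>+ x. ennreal (\<phi> (0, p) (x, q)) \<partial>lborel) \<partial>(Q \<Otimes>\<^sub>M Q)) < \<infinity>"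

text \<open>Edges are two-element sets of vertices.\<close>

definition pairs :: "'x set \<Rightarrow> 'x set set" where
  "pairs V = {e. e \<subseteq> V \<and> card e = 2}"

definition edge_prob :: "('x \<Rightarrow> 'x \<Rightarrow> real) \<Rightarrow> 'x set \<Rightarrow> real" where
  "edge_prob \<phi> e = (THE r. \<exists>x y. e = {x, y} \<and> x \<noteq> y \<and> r = \<phi> x y)"

lemma edge_prob_pair:
  assumes "\<And>x y. \<phi> x y = \<phi> y x" "x \<noteq> y"
  shows "edge_prob \<phi> {x, y} = \<phi> x y"
  unfolding edge_prob_def
proof (rule the_equality)
  show "\<exists>x' y'. {x, y} = {x', y'} \<and> x' \<noteq> y' \<and> \<phi> x y = \<phi> x' y'"
    using assms(2) by blast
next
  fix r assume "\<exists>x' y'. {x, y} = {x', y'} \<and> x' \<noteq> y' \<and> r = \<phi> x' y'"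
  then show "r = \<phi> x y"
    using assms(1) by (metis doubleton_eq_iff)
qed

text \<open>The conditional law of the edge configuration of the random graph, given its vertex set.\<close>

definition edge_law :: "('x \<Rightarrow> 'x \<Rightarrow> real) \<Rightarrow> 'x set \<Rightarrow> ('x set \<Rightarrow> bool) measure" where
  "edge_law \<phi> V = (\<Pi>\<^sub>M e\<in>pairs V. measure_pmf (bernoulli_pmf (edge_prob \<phi> e)))"

definition edges :: "'x set \<Rightarrow> ('x set \<Rightarrow> bool) \<Rightarrow> 'x set set" where
  "edges V c = {e \<in> pairs V. c e}"

definition connected_in :: "'x set set \<Rightarrow> 'x \<Rightarrow> 'x \<Rightarrow> bool" where
  "connected_in E = (\<lambda>x y. {x, y} \<in> E)\<^sup>*\<^sup>*"

text \<open>
  \<open>rcm_prob P \<phi> \<eta> G\<close> is the probability that the random connection model based on the point process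
  \<open>\<eta>\<close>, defined on the probability space \<open>P\<close>, has the property \<open>G\<close> of graphs with given vertex set
  and edge set: the conditional probability given \<open>\<eta>\<close>, integrated over \<open>\<eta>\<close>.
\<close>

definition rcm_prob ::
  "'w measure \<Rightarrow> ('x \<Rightarrow> 'x \<Rightarrow> real) \<Rightarrow> ('w \<Rightarrow> 'x set) \<Rightarrow> ('x set \<Rightarrow> 'x set set \<Rightarrow> bool) \<Rightarrow> ennreal" where
  "rcm_prob P \<phi> \<eta> G =
     (\<integral>\<^sup>+ \<omega>. emeasure (edge_law \<phi> (\<eta> \<omega>))
        {c \<in> space (edge_law \<phi> (\<eta> \<omega>)). G (\<eta> \<omega>) (edges (\<eta> \<omega>) c)} \<partial>P)"

text \<open>
  The point process \<open>\<eta> + \<delta>\<^bsub>z1\<^esub> + \<delta>\<^bsub>z2\<^esub>\<close> corresponds to the random set \<open>\<eta> \<union> {z1, z2}\<close>. For almost all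
  \<open>z1\<close> and \<open>z2\<close>, the two points are distinct and almost surely not in \<open>\<eta>\<close>.
\<close>

definition irreducible_rcm ::
  "'w measure \<Rightarrow> 'm measure \<Rightarrow> ('a::euclidean_space \<times> 'm \<Rightarrow> 'a \<times> 'm \<Rightarrow> real) \<Rightarrow>
     ('w \<Rightarrow> ('a \<times> 'm) set) \<Rightarrow> bool" where
  "irreducible_rcm P Q \<phi> \<eta> \<longleftrightarrow>
     (AE (z1, z2) in lam Q \<Otimes>\<^sub>M lam Q.
        rcm_prob P \<phi> (\<lambda>\<omega>. \<eta> \<omega> \<union> {z1, z2}) (\<lambda>V E. connected_in E z1 z2) > 0)"

text \<open>
  The following two facts show that \<^const>\<open>edge_law\<close> is a probability measure and that, for a
  countable vertex set, the event of being connected is measurable.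
\<close>

lemma prob_space_edge_law: "prob_space (edge_law \<phi> V)"
  unfolding edge_law_def by (intro prob_space_PiM prob_space_measure_pmf)

lemma connected_event_measurable:
  assumes V: "countable V" and x: "x \<in> V"
  shows "{c \<in> space (edge_law \<phi> V). connected_in (edges V c) x y} \<in> sets (edge_law \<phi> V)"
proof -
  let ?M = "edge_law \<phi> V"
  define R where "R c = (\<lambda>x y. {x, y} \<in> edges V c)" for c
  have R_in: "R c a b \<Longrightarrow> b \<in> V" for c a b
    unfolding R_def edges_def pairs_def by auto
  have R_meas: "{c \<in> space ?M. R c a b} \<in> sets ?M" for a b
  proof (cases "{a, b} \<in> pairs V")
    case True
    have "(\<lambda>c. c {a, b}) \<in> measurable ?M (measure_pmf (bernoulli_pmf (edge_prob \<phi> {a, b})))"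
      unfolding edge_law_def using True by (rule measurable_component_singleton)
    then have "(\<lambda>c. c {a, b}) \<in> measurable ?M (count_space UNIV)"
      by simp
    from measurable_sets[OF this, of "{True}"]
    have "(\<lambda>c. c {a, b}) -` {True} \<inter> space ?M \<in> sets ?M" by simp
    also have "(\<lambda>c. c {a, b}) -` {True} \<inter> space ?M = {c \<in> space ?M. R c a b}"
      using True by (auto simp: R_def edges_def)
    finally show ?thesis .
  next
    case False
    then have "{c \<in> space ?M. R c a b} = {}" by (auto simp: R_def edges_def)
    then show ?thesis by (simp only: sets.empty_sets)
  qed
  have path: "{c \<in> space ?M. (R c ^^ n) x b} \<in> sets ?M" for n b
  proof (induction n arbitrary: b)
    case 0
    show ?case by (cases "x = b") auto
  next
    case (Suc n)
    have mem: "a \<in> V" if "(R c ^^ n) x a" for c a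
      using that x by (cases n) (auto dest: R_in)
    have "{c \<in> space ?M. (R c ^^ Suc n) x b} =
        (\<Union>a\<in>V. {c \<in> space ?M. (R c ^^ n) x a} \<inter> {c \<in> space ?M. R c a b})"
      using mem by auto
    also have "\<dots> \<in> sets ?M"
      using V Suc.IH R_meas by (intro sets.countable_UN' sets.Int) auto
    finally show ?case .
  qed
  have "{c \<in> space ?M. connected_in (edges V c) x y} = (\<Union>n. {c \<in> space ?M. (R c ^^ n) x y})"
    unfolding connected_in_def R_def[symmetric] by (auto simp: rtranclp_power)
  also have "\<dots> \<in> sets ?M" using path by auto
  finally show ?thesis .
qed


section \<open>Ordered mark spaces\<close>

definition pop_order :: "('m::polish_space \<Rightarrow> 'm \<Rightarrow> bool) \<Rightarrow> bool" where
  "pop_order le \<longleftrightarrow>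
     reflp le \<and> antisymp le \<and> transp le \<and>
     {(p, q). le p q} \<in> sets (borel \<Otimes>\<^sub>M borel)"

definition associated :: "'m measure \<Rightarrow> ('m \<Rightarrow> 'm \<Rightarrow> bool) \<Rightarrow> bool" where
  "associated Q le \<longleftrightarrow>
     (\<forall>f g :: 'm \<Rightarrow> real.
        f \<in> borel_measurable Q \<and> g \<in> borel_measurable Q \<and>
        monotone le (\<le>) f \<and> monotone le (\<le>) g \<and>
        integrable Q f \<and> integrable Q g \<and> integrable Q (\<lambda>p. f p * g p) \<longrightarrow>
        (\<integral>p. f p * g p \<partial>Q) \<ge> (\<integral>p. f p \<partial>Q) * (\<integral>p. g p \<partial>Q))"

end

theory Submission
  imports Defs
begin

text \<open>
If \<open>\<integral> d_phi \<phi> p q Q(dq) = 0\<close>, then \<open>\<phi> (x, p) w = 0\<close> for almost all \<open>w\<close>. Almost surely the Poisson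
process has no point in the exceptional null set, so \<open>(x, p)\<close> is an isolated vertex
(\<open>isolated_not_connected\<close>). Irreducibility therefore forces positive expected degrees.

For the converse, let \<open>reach z\<close> be the set of all \<open>w\<close> for which the chains
\<open>z, x\<^sub>0, \<dots>, x\<^sub>n\<^sub>-\<^sub>1, w\<close> with \<open>\<phi>\<close> bounded below along all steps have positive measure for some \<open>n\<close>.
With positive probability the Poisson process contains the inner points of such a chain, and then
all edges of the chain are present with a probability that is bounded below; so \<open>z\<close> and \<open>w\<close> are
connected with positive probability (\<open>reach_imp_connected\<close>). It remains to show that \<open>reach z\<close>
has full measure for almost all \<open>z\<close>.

The set \<open>A = reach z\<close> is closed: if \<open>w \<notin> A\<close>, then \<open>\<phi> u w = 0\<close> for almost all \<open>u \<in> A\<close>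
(\<open>reach_closed\<close>). Let \<open>A\<^sub>r\<close> be the section of \<open>A\<close> at the mark \<open>r\<close>. Closedness means that, for almost all
marks \<open>r\<close> and \<open>s\<close>, the set \<open>A\<^sub>s\<close> shifted by \<open>-v\<close> agrees with \<open>A\<^sub>r\<close> up to a null set for almost every \<open>v\<close> with
\<open>\<phi> (0, r) (v, s) > 0\<close>. If \<open>d_phi \<phi> r s > 0\<close>, then these \<open>v\<close> have positive measure, so \<open>A\<^sub>s\<close> is
invariant under the differences of a set of positive measure. These differences generate the whole
translation group, and hence \<open>A\<^sub>r\<close> and \<open>A\<^sub>s\<close> are either both null or both of full measure
(\<open>closed_set_sections\<close>).

Finally, association links almost all marks in two steps. For marks \<open>p\<close> and \<open>q\<close> with positive
expected degree it gives
\<open>\<integral> d_phi \<phi> p r * d_phi \<phi> q r Q(dr) \<ge> \<integral> d_phi \<phi> p r Q(dr) * \<integral> d_phi \<phi> q r Q(dr) > 0\<close> (up to truncation),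
so there are plenty of common neighbours \<open>r\<close> (\<open>associated_common_support\<close>). Thus either
almost all sections of \<open>A\<close> are null or almost all are full (\<open>closed_set_trivial\<close>), and the first is impossible
for \<open>reach z\<close>, because it contains all \<open>w\<close> with \<open>\<phi> z w > 0\<close>, a set of positive measure whenever the mark of
\<open>z\<close> has positive expected degree.
\<close>

section \<open>Point configurations of a Poisson process\<close>

lemma num_points_eq_1_iff: "num_points V B = 1 \<longleftrightarrow> (\<exists>x. V \<inter> B = {x})"
proof
  assume *: "num_points V B = 1"
  then have fin: "finite (V \<inter> B)"
    unfolding num_points_def by (rule_tac ccontr) simp
  with * have "card (V \<inter> B) = 1"
    unfolding num_points_def by (simp add: emeasure_count_space_finite)
  then show "\<exists>x. V \<inter> B = {x}" by (simp add: card_1_singleton_iff)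
qed (auto simp: num_points_def)

lemma num_points_eq_0_iff: "num_points V B = 0 \<longleftrightarrow> V \<inter> B = {}"
  unfolding num_points_def by (subst emeasure_count_space_eq_0) auto

lemma prod_lessThan_double:
  "(\<Prod>j<2 * n. f j) = (\<Prod>i<n. f (2 * i) * f (2 * i + 1 :: nat) :: 'b::comm_monoid_mult)"
  by (induction n) (simp_all add: mult.assoc)

text \<open>The \<open>2 * n\<close> sets \<open>B i \<inter> A i\<close> and \<open>B i - A i\<close> are disjoint, so their numbers of points are independent.
In the event, each \<open>B i\<close> contains exactly one point, and that point is in \<open>A i\<close>; the two Poisson
probabilities belonging to \<open>i\<close> combine to \<open>exp (- measure \<mu> (B i))\<close> times the measure of \<open>B i \<inter> A i\<close>.\<close>

lemma poisson_point_hits_boxes_prob: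
  fixes n :: nat
  assumes pp: "poisson_process P \<mu> \<eta>"
    and B: "\<And>i. i < n \<Longrightarrow> B i \<in> sets \<mu>" "\<And>i. i < n \<Longrightarrow> emeasure \<mu> (B i) < \<infinity>"
    and disj: "disjoint_family_on B {..<n}"
    and A: "\<And>i. i < n \<Longrightarrow> A i \<in> sets \<mu>"
  shows "emeasure P {\<omega>\<in>space P. \<forall>i<n. num_points (\<eta> \<omega>) (B i \<inter> A i) = 1 \<and> num_points (\<eta> \<omega>) (B i - A i) = 0}
    = (\<Prod>i<n. ennreal (exp (- measure \<mu> (B i))) * emeasure \<mu> (B i \<inter> A i))"
proof (cases "n = 0")
  case True
  interpret P: prob_space P using pp by (simp add: poisson_process_def)
  show ?thesis using True P.emeasure_space_1 by simp
next
  case False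
  interpret P: prob_space P using pp by (simp add: poisson_process_def)
  \<comment> \<open>Even indices enumerate the sets that should contain one point, odd ones those that should be empty.\<close>
  define C where "C j = (if even j then B (j div 2) \<inter> A (j div 2) else B (j div 2) - A (j div 2))" for j
  define k :: "nat \<Rightarrow> nat" where "k j = (if even j then 1 else 0)" for j
  have C_sub: "C j \<subseteq> B (j div 2)" for j by (auto simp: C_def)
  have C[measurable]: "C j \<in> sets \<mu>" if "j < 2 * n" for j
    using that B(1)[of "j div 2"] A[of "j div 2"] by (auto simp: C_def)
  have C_fin: "emeasure \<mu> (C j) < \<infinity>" if "j < 2 * n" for j
  proof -
    have "j div 2 < n" using that by auto
    then show ?thesis
      using emeasure_mono[OF C_sub B(1), of j] B(2)[of "j div 2"] by (auto intro: le_less_trans)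
  qed
  have C_disj: "disjoint_family_on C {..<2 * n}"
    unfolding disjoint_family_on_def
  proof (intro ballI impI)
    fix i j assume ij: "i \<in> {..<2 * n}" "j \<in> {..<2 * n}" "i \<noteq> j"
    show "C i \<inter> C j = {}"
    proof (cases "i div 2 = j div 2")
      case True
      with ij have "even i \<noteq> even j" by presburger
      with True show ?thesis by (auto simp: C_def)
    next
      case F: False
      have "i div 2 < n" "j div 2 < n" using ij by auto
      then have "B (i div 2) \<inter> B (j div 2) = {}"
        using disj F by (auto simp: disjoint_family_on_def)
      then show ?thesis using C_sub[of i] C_sub[of j] by blast
    qed
  qed
  have indep: "P.indep_vars (\<lambda>_. borel) (\<lambda>j \<omega>. num_points (\<eta> \<omega>) (C j)) {..<2 * n}"
    using pp C C_disj unfolding poisson_process_def by blast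
  have one: "P.prob {\<omega>\<in>space P. num_points (\<eta> \<omega>) (C j) = of_nat l} =
      measure \<mu> (C j) ^ l / fact l * exp (- measure \<mu> (C j))" if "j < 2 * n" for j l
    using pp C[OF that] C_fin[OF that] unfolding poisson_process_def by blast
  have "{\<omega>\<in>space P. \<forall>i<n. num_points (\<eta> \<omega>) (B i \<inter> A i) = 1 \<and> num_points (\<eta> \<omega>) (B i - A i) = 0} =
      (\<Inter>j\<in>{..<2 * n}. (\<lambda>\<omega>. num_points (\<eta> \<omega>) (C j)) -` {of_nat (k j)} \<inter> space P)" (is "?L = ?R")
  proof (intro set_eqI iffI)
    fix \<omega> assume "\<omega> \<in> ?L"
    then show "\<omega> \<in> ?R" by (auto simp: C_def k_def)
  next
    fix \<omega> assume R: "\<omega> \<in> ?R"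
    have "0 \<in> {..<2 * n}" using False by simp
    with R have "\<omega> \<in> space P" by blast
    moreover have "num_points (\<eta> \<omega>) (B i \<inter> A i) = 1 \<and> num_points (\<eta> \<omega>) (B i - A i) = 0" if "i < n" for i
    proof -
      have "2 * i \<in> {..<2 * n}" "2 * i + 1 \<in> {..<2 * n}" using that by auto
      with R have "num_points (\<eta> \<omega>) (C (2 * i)) = of_nat (k (2 * i))"
        "num_points (\<eta> \<omega>) (C (2 * i + 1)) = of_nat (k (2 * i + 1))"
        by (blast, blast)
      then show ?thesis by (simp add: C_def k_def)
    qed
    ultimately show "\<omega> \<in> ?L" by blast
  qed
  also have "P.prob \<dots> = (\<Prod>j<2 * n. P.prob ((\<lambda>\<omega>. num_points (\<eta> \<omega>) (C j)) -` {of_nat (k j)} \<inter> space P))"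
    using False by (intro P.indep_varsD[OF indep]) (auto simp: lessThan_empty_iff)
  also have "\<dots> = (\<Prod>j<2 * n. measure \<mu> (C j) ^ k j / fact (k j) * exp (- measure \<mu> (C j)))"
  proof (intro prod.cong refl)
    fix j assume "j \<in> {..<2 * n}"
    moreover have "(\<lambda>\<omega>. num_points (\<eta> \<omega>) (C j)) -` {of_nat (k j)} \<inter> space P =
      {\<omega>\<in>space P. num_points (\<eta> \<omega>) (C j) = of_nat (k j)}" by auto
    ultimately show "P.prob ((\<lambda>\<omega>. num_points (\<eta> \<omega>) (C j)) -` {of_nat (k j)} \<inter> space P) =
       measure \<mu> (C j) ^ k j / fact (k j) * exp (- measure \<mu> (C j))" using one by simp
  qed
  also have "\<dots> = (\<Prod>i<n. exp (- measure \<mu> (B i)) * measure \<mu> (B i \<inter> A i))"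
    unfolding prod_lessThan_double
  proof (intro prod.cong refl)
    fix i assume "i \<in> {..<n}"
    then have i: "i < n" by simp
    have "measure \<mu> (B i) = measure \<mu> (B i \<inter> A i) + measure \<mu> (B i - A i)"
    proof -
      have "measure \<mu> ((B i \<inter> A i) \<union> (B i - A i)) = measure \<mu> (B i \<inter> A i) + measure \<mu> (B i - A i)"
        using C_fin[of "2 * i"] C_fin[of "2 * i + 1"] i A B(1)
        by (intro measure_Union) (auto simp: C_def)
      then show ?thesis by (simp add: Int_Diff_Un)
    qed
    then show "measure \<mu> (C (2 * i)) ^ k (2 * i) / fact (k (2 * i)) * exp (- measure \<mu> (C (2 * i))) *
         (measure \<mu> (C (2 * i + 1)) ^ k (2 * i + 1) / fact (k (2 * i + 1)) *
          exp (- measure \<mu> (C (2 * i + 1)))) = exp (- measure \<mu> (B i)) * measure \<mu> (B i \<inter> A i)"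
      by (simp add: C_def k_def mult.assoc mult_exp_exp mult.commute)
  qed
  finally have "P.prob ?L = (\<Prod>i<n. exp (- measure \<mu> (B i)) * measure \<mu> (B i \<inter> A i))" .
  then have "emeasure P ?L = (\<Prod>i<n. ennreal (exp (- measure \<mu> (B i)) * measure \<mu> (B i \<inter> A i)))"
    by (simp add: P.emeasure_eq_measure prod_ennreal)
  also have "\<dots> = (\<Prod>i<n. ennreal (exp (- measure \<mu> (B i))) * emeasure \<mu> (B i \<inter> A i))"
  proof (intro prod.cong refl)
    fix i assume "i \<in> {..<n}"
    then have "emeasure \<mu> (B i \<inter> A i) \<noteq> \<infinity>" using C_fin[of "2 * i"] by (auto simp: C_def)
    then show "ennreal (exp (- measure \<mu> (B i)) * measure \<mu> (B i \<inter> A i)) =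
        ennreal (exp (- measure \<mu> (B i))) * emeasure \<mu> (B i \<inter> A i)"
      by (simp add: ennreal_mult emeasure_eq_ennreal_measure)
  qed
  finally show ?thesis .
qed

text \<open>Given that each box contains exactly one point, these points are distributed like independent
samples from \<open>\<mu>\<close> restricted to the boxes. Hence the tuple of points falls into any set \<open>T\<close> of
positive product measure with positive probability. The conclusion provides an event \<open>E\<close>, so that nothing
has to be shown about the measurability of the set of all \<open>\<omega>\<close> for which \<open>\<eta> \<omega>\<close> contains a tuple in \<open>T\<close>.\<close>

lemma poisson_points_in_product_set:
  fixes n :: nat
  assumes pp: "poisson_process P \<mu> \<eta>" and sf: "sigma_finite_measure \<mu>"
    and B: "\<And>i. i < n \<Longrightarrow> B i \<in> sets \<mu>" "\<And>i. i < n \<Longrightarrow> emeasure \<mu> (B i) < \<infinity>"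
    and disj: "disjoint_family_on B {..<n}"
    and T: "T \<in> sets (\<Pi>\<^sub>M i\<in>{..<n}. \<mu>)" "T \<subseteq> Pi\<^sub>E {..<n} B" "emeasure (\<Pi>\<^sub>M i\<in>{..<n}. \<mu>) T > 0"
  shows "\<exists>E\<in>sets P. emeasure P E > 0 \<and> (\<forall>\<omega>\<in>E. \<exists>x\<in>T. \<forall>i<n. x i \<in> \<eta> \<omega>)"
proof -
  interpret P: prob_space P using pp by (simp add: poisson_process_def)
  interpret mu: sigma_finite_measure \<mu> by fact
  interpret Pmu: product_sigma_finite "\<lambda>_. \<mu>" by standard
  define L where "L = (\<Pi>\<^sub>M i\<in>{..<n}. \<mu>)"
  have T': "T \<in> sets L" using T(1) by (simp add: L_def)
  have num_meas[measurable]: "(\<lambda>\<omega>. num_points (\<eta> \<omega>) C) \<in> borel_measurable P" if "C \<in> sets \<mu>" for C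
    using pp that by (auto simp: poisson_process_def)
  have eta_sp: "\<eta> \<omega> \<subseteq> space \<mu>" if "\<omega> \<in> space P" for \<omega>
    using pp that by (auto simp: poisson_process_def)
  define E0 where "E0 = {\<omega>\<in>space P. \<forall>i<n. num_points (\<eta> \<omega>) (B i) = 1}"
  have E0[measurable]: "E0 \<in> sets P"
  proof -
    have "E0 = {\<omega>\<in>space P. \<forall>i\<in>{..<n}. num_points (\<eta> \<omega>) (B i) = 1}" by (auto simp: E0_def)
    also have "\<dots> \<in> sets P"
    proof (rule sets.sets_Collect_finite_All)
      fix i assume "i \<in> {..<n}"
      then have [measurable]: "B i \<in> sets \<mu>" using B by auto
      show "{\<omega> \<in> space P. num_points (\<eta> \<omega>) (B i) = 1} \<in> sets P" by measurable
    qed simp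
    finally show ?thesis .
  qed
  \<comment> \<open>On \<open>E0\<close>, where each box contains exactly one point, \<open>X\<close> is the tuple of these points.\<close>
  define X where "X \<omega> = (\<lambda>i\<in>{..<n}. THE x. x \<in> \<eta> \<omega> \<inter> B i)" for \<omega>
  have X: "\<eta> \<omega> \<inter> B i = {X \<omega> i}" if \<omega>: "\<omega> \<in> E0" and i: "i < n" for \<omega> i
  proof -
    obtain x where x: "\<eta> \<omega> \<inter> B i = {x}"
      using \<omega> i by (auto simp: E0_def num_points_eq_1_iff)
    have "X \<omega> i = x" unfolding X_def using i by (simp add: x del: Int_iff)
    with x show ?thesis by simp
  qed
  have X_in: "X \<omega> i \<in> A \<longleftrightarrow> num_points (\<eta> \<omega>) (B i \<inter> A) = 1 \<and> num_points (\<eta> \<omega>) (B i - A) = 0"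
    if "\<omega> \<in> E0" "i < n" for \<omega> i A
  proof -
    have "\<eta> \<omega> \<inter> (B i \<inter> A) = {X \<omega> i} \<inter> A" "\<eta> \<omega> \<inter> (B i - A) = {X \<omega> i} - A"
      using X[OF that] by blast+
    then show ?thesis unfolding num_points_eq_1_iff num_points_eq_0_iff by auto
  qed
  let ?P0 = "restrict_space P E0"
  have X_meas: "X \<in> measurable ?P0 L"
    unfolding L_def X_def
  proof (rule measurable_restrict)
    fix i assume i: "i \<in> {..<n}"
    show "(\<lambda>\<omega>. THE x. x \<in> \<eta> \<omega> \<inter> B i) \<in> measurable ?P0 \<mu>"
    proof (rule measurableI)
      fix \<omega> assume "\<omega> \<in> space ?P0"
      then have \<omega>: "\<omega> \<in> E0" by (simp add: space_restrict_space)
      have "X \<omega> i \<in> \<eta> \<omega>" using X[OF \<omega>, of i] i by auto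
      moreover have "\<omega> \<in> space P" using \<omega> by (simp add: E0_def)
      ultimately have "X \<omega> i \<in> space \<mu>" using eta_sp by blast
      then show "(THE x. x \<in> \<eta> \<omega> \<inter> B i) \<in> space \<mu>" using i by (simp add: X_def)
    next
      fix A assume A: "A \<in> sets \<mu>"
      have [measurable]: "B i \<inter> A \<in> sets \<mu>" "B i - A \<in> sets \<mu>" using A B i by auto
      have "(\<lambda>\<omega>. THE x. x \<in> \<eta> \<omega> \<inter> B i) -` A \<inter> space ?P0 = {\<omega>\<in>E0. X \<omega> i \<in> A}"
        using i E0 sets.sets_into_space by (auto simp: X_def space_restrict_space)
      also have "\<dots> = E0 \<inter> {\<omega>\<in>space P. num_points (\<eta> \<omega>) (B i \<inter> A) = 1 \<and> num_points (\<eta> \<omega>) (B i - A) = 0}"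
        using X_in[of _ i A] i by (auto simp: E0_def)
      also have "\<dots> \<in> sets ?P0"
        using E0 by (auto simp: sets_restrict_space)
      finally show "(\<lambda>\<omega>. THE x. x \<in> \<eta> \<omega> \<inter> B i) -` A \<inter> space ?P0 \<in> sets ?P0" .
    qed
  qed
  \<comment> \<open>Empty boxes beyond \<open>n\<close> make all the measures \<open>M i\<close> below finite.\<close>
  define B' where "B' i = (if i < n then B i else {})" for i
  have B': "B' i \<in> sets \<mu>" "emeasure \<mu> (B' i) < \<infinity>" for i using B by (auto simp: B'_def)
  define c where "c i = ennreal (exp (- measure \<mu> (B' i)))" for i
  define M where "M i = density \<mu> (\<lambda>x. c i * indicator (B' i) x)" for i
  have M_emeasure: "emeasure (M i) A = c i * emeasure \<mu> (B' i \<inter> A)" if "A \<in> sets \<mu>" for i A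
  proof -
    have "emeasure (M i) A = (\<integral>\<^sup>+x. c i * indicator (B' i \<inter> A) x \<partial>\<mu>)"
      unfolding M_def using that B' by (subst emeasure_density)
        (auto intro!: nn_integral_cong simp: indicator_def)
    also have "\<dots> = c i * emeasure \<mu> (B' i \<inter> A)"
      using that B' by (subst nn_integral_cmult_indicator) auto
    finally show ?thesis .
  qed
  have M_sets[measurable_cong]: "sets (M i) = sets \<mu>" for i by (simp add: M_def)
  have M_fin: "finite_measure (M i)" for i
  proof
    have "emeasure (M i) (space (M i)) = c i * emeasure \<mu> (B' i \<inter> space \<mu>)"
      using M_emeasure[of "space \<mu>" i] by (simp add: M_def)
    also have "\<dots> < \<infinity>"
      using B'[of i] sets.Int_space_eq2[OF B'(1)[of i]] by (simp add: c_def ennreal_mult_less_top)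
    finally show "emeasure (M i) (space (M i)) \<noteq> \<infinity>" by simp
  qed
  interpret PM: product_sigma_finite M
    using M_fin by (auto intro!: product_sigma_finite.intro finite_measure.axioms)
  have PM_sets: "sets (PiM {..<n} M) = sets L"
    unfolding L_def by (rule sets_PiM_cong) (auto simp: M_sets)
  \<comment> \<open>Both the law of \<open>X\<close> and a measure with a density with respect to \<open>L\<close> agree with the product of the
    \<open>M i\<close> on rectangles.\<close>
  have law: "distr ?P0 L X = PiM {..<n} M"
  proof (rule PM.PiM_eqI)
    fix A assume "\<And>i. i \<in> {..<n} \<Longrightarrow> A i \<in> sets (M i)"
    then have A: "\<And>i. i < n \<Longrightarrow> A i \<in> sets \<mu>" by (auto simp: M_sets)
    have "Pi\<^sub>E {..<n} A \<in> sets L" unfolding L_def using A by (intro sets_PiM_I_finite) auto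
    then have "emeasure (distr ?P0 L X) (Pi\<^sub>E {..<n} A) = emeasure ?P0 (X -` Pi\<^sub>E {..<n} A \<inter> space ?P0)"
      by (rule emeasure_distr[OF X_meas])
    also have "X -` Pi\<^sub>E {..<n} A \<inter> space ?P0 = {\<omega>\<in>E0. \<forall>i<n. X \<omega> i \<in> A i}"
      using E0 sets.sets_into_space by (auto simp: space_restrict_space X_def PiE_iff)
    also have LR: "\<dots> = {\<omega>\<in>space P. \<forall>i<n. num_points (\<eta> \<omega>) (B i \<inter> A i) = 1 \<and> num_points (\<eta> \<omega>) (B i - A i) = 0}" (is "?L = ?R")
    proof (intro set_eqI iffI)
      fix \<omega> assume "\<omega> \<in> ?L" then show "\<omega> \<in> ?R" using X_in by (auto simp: E0_def)
    next
      fix \<omega> assume R: "\<omega> \<in> ?R"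
      have "num_points (\<eta> \<omega>) (B i) = 1" if "i < n" for i
      proof -
        have "num_points (\<eta> \<omega>) (B i \<inter> A i) = 1" "num_points (\<eta> \<omega>) (B i - A i) = 0" using R that by auto
        then show ?thesis unfolding num_points_eq_1_iff num_points_eq_0_iff by blast
      qed
      with R have "\<omega> \<in> E0" by (simp add: E0_def)
      with R show "\<omega> \<in> ?L" using X_in by auto
    qed
    also have "emeasure ?P0 ?R = emeasure P ?R"
    proof -
      have "?R \<subseteq> E0" unfolding LR[symmetric] by auto
      then show ?thesis by (intro emeasure_restrict_space) (use E0 in auto)
    qed
    also have "\<dots> = (\<Prod>i<n. ennreal (exp (- measure \<mu> (B i))) * emeasure \<mu> (B i \<inter> A i))"
      by (rule poisson_point_hits_boxes_prob[OF pp B disj A])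
    also have "\<dots> = (\<Prod>i<n. emeasure (M i) (A i))"
      using A by (intro prod.cong refl) (auto simp: M_emeasure c_def B'_def)
    finally show "emeasure (distr ?P0 L X) (Pi\<^sub>E {..<n} A) = (\<Prod>i<n. emeasure (M i) (A i))" .
  qed (simp_all add: PM_sets)
  have dens: "density L (\<lambda>x. \<Prod>i<n. c i * indicator (B' i) (x i)) = PiM {..<n} M"
  proof (rule PM.PiM_eqI)
    fix A assume "\<And>i. i \<in> {..<n} \<Longrightarrow> A i \<in> sets (M i)"
    then have A: "\<And>i. i < n \<Longrightarrow> A i \<in> sets \<mu>" by (auto simp: M_sets)
    have PA: "Pi\<^sub>E {..<n} A \<in> sets L" unfolding L_def using A by (intro sets_PiM_I_finite) auto
    have "emeasure (density L (\<lambda>x. \<Prod>i<n. c i * indicator (B' i) (x i))) (Pi\<^sub>E {..<n} A) =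
       (\<integral>\<^sup>+x. (\<Prod>i<n. c i * indicator (B' i) (x i)) * indicator (Pi\<^sub>E {..<n} A) x \<partial>L)"
      using PA B' by (intro emeasure_density) (auto simp: L_def)
    also have "\<dots> = (\<integral>\<^sup>+x. (\<Prod>i<n. c i * indicator (B' i \<inter> A i) (x i)) \<partial>L)"
    proof (intro nn_integral_cong)
      fix x assume x: "x \<in> space L"
      show "(\<Prod>i<n. c i * indicator (B' i) (x i)) * indicator (Pi\<^sub>E {..<n} A) x =
        (\<Prod>i<n. c i * indicator (B' i \<inter> A i) (x i))"
      proof (cases "x \<in> Pi\<^sub>E {..<n} A")
        case True
        then show ?thesis by (auto intro!: prod.cong simp: indicator_def PiE_iff)
      next
        case False
        then obtain i where "i < n" "x i \<notin> A i"
          using x by (auto simp: L_def space_PiM PiE_iff)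
        then have "(\<Prod>i<n. c i * indicator (B' i \<inter> A i) (x i)) = 0"
          by (intro prod_zero) (auto intro!: bexI[of _ i])
        with False show ?thesis by simp
      qed
    qed
    also have "\<dots> = (\<Prod>i<n. \<integral>\<^sup>+x. c i * indicator (B' i \<inter> A i) x \<partial>\<mu>)"
      unfolding L_def using A B' by (intro Pmu.product_nn_integral_prod) auto
    also have "\<dots> = (\<Prod>i<n. emeasure (M i) (A i))"
      using A B' by (intro prod.cong refl, subst nn_integral_cmult_indicator) (auto simp: M_emeasure)
    finally show "emeasure (density L (\<lambda>x. \<Prod>i<n. c i * indicator (B' i) (x i))) (Pi\<^sub>E {..<n} A) =
      (\<Prod>i<n. emeasure (M i) (A i))" .
  qed (simp_all add: PM_sets)
  have "emeasure (PiM {..<n} M) T = (\<integral>\<^sup>+x. (\<Prod>i<n. c i * indicator (B' i) (x i)) * indicator T x \<partial>L)"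
    unfolding dens[symmetric] using T' B' by (intro emeasure_density) (auto simp: L_def)
  also have "\<dots> = (\<integral>\<^sup>+x. (\<Prod>i<n. c i) * indicator T x \<partial>L)"
  proof (intro nn_integral_cong)
    fix x
    show "(\<Prod>i<n. c i * indicator (B' i) (x i)) * indicator T x = (\<Prod>i<n. c i) * indicator T x"
      using T(2) by (auto simp: indicator_def B'_def PiE_iff subset_eq intro!: prod.cong)
  qed
  also have "\<dots> = (\<Prod>i<n. c i) * emeasure L T"
    using T' by (rule nn_integral_cmult_indicator)
  also have "\<dots> > 0"
  proof -
    have "(\<Prod>i<n. c i) = ennreal (\<Prod>i<n. exp (- measure \<mu> (B' i)))"
      unfolding c_def by (subst prod_ennreal) auto
    then have "(\<Prod>i<n. c i) > 0" by (simp add: prod_pos)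
    with T(3) show ?thesis by (simp add: L_def ennreal_zero_less_mult_iff)
  qed
  finally have pos: "emeasure (PiM {..<n} M) T > 0" .
  define E where "E = X -` T \<inter> space ?P0"
  have E: "E \<in> sets ?P0" unfolding E_def by (rule measurable_sets[OF X_meas T'])
  then have E': "E \<in> sets P" "E \<subseteq> E0"
    using E0 by (auto simp: sets_restrict_space)
  have "emeasure P E = emeasure ?P0 E"
    using E' E0 by (intro emeasure_restrict_space[symmetric]) auto
  also have "\<dots> = emeasure (PiM {..<n} M) T"
    unfolding law[symmetric] E_def by (rule emeasure_distr[OF X_meas T', symmetric])
  finally have "emeasure P E > 0" using pos by simp
  moreover have "\<exists>x\<in>T. \<forall>i<n. x i \<in> \<eta> \<omega>" if "\<omega> \<in> E" for \<omega>
  proof (intro bexI allI impI)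
    show "X \<omega> \<in> T" using that by (simp add: E_def)
    show "X \<omega> i \<in> \<eta> \<omega>" if "i < n" for i using X[of \<omega> i] that \<open>\<omega> \<in> E\<close> E' by auto
  qed
  ultimately show ?thesis using E' by blast
qed

text \<open>The boxes are level sets of \<open>\<lfloor>k * f u\<rfloor>\<close> within sets of finite measure. For \<open>k\<close> large enough, they
separate any finite number of points with distinct values of \<open>f\<close>, and there are only countably
many of them; so not all the boxes can meet \<open>S\<close> in null sets.\<close>

lemma (in sigma_finite_measure) separating_boxes:
  fixes n :: nat
  assumes f[measurable]: "f \<in> borel_measurable M"
    and S: "S \<in> sets (\<Pi>\<^sub>M i\<in>{..<n}. M)" "emeasure (\<Pi>\<^sub>M i\<in>{..<n}. M) S > 0"
    and inj: "\<And>x. x \<in> S \<Longrightarrow> inj_on (\<lambda>i. f (x i) :: real) {..<n}"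
  shows "\<exists>B. disjoint_family_on B {..<n} \<and> (\<forall>i<n. B i \<in> sets M \<and> emeasure M (B i) < \<infinity>) \<and>
    emeasure (\<Pi>\<^sub>M i\<in>{..<n}. M) (S \<inter> Pi\<^sub>E {..<n} B) > 0"
proof -
  obtain A :: "nat \<Rightarrow> 'a set" where A: "range A \<subseteq> sets M" "(\<Union>i. A i) = space M"
      "\<And>i. emeasure M (A i) \<noteq> \<infinity>" "incseq A"
    using sigma_finite_incseq by metis
  \<comment> \<open>The list \<open>js\<close> contains the level of the \<open>i\<close>-th factor at position \<open>i\<close>; distinct levels give disjoint boxes.\<close>
  define B where "B = (\<lambda>(k::nat, js::int list) i. A k \<inter> {u \<in> space M. \<lfloor>real k * f u\<rfloor> = js ! i})"
  have B_sets: "B q i \<in> sets M" for q i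
    using A(1) by (auto simp: B_def split: prod.split)
  have B_fin: "emeasure M (B q i) < \<infinity>" for q i
  proof -
    have "emeasure M (B q i) \<le> emeasure M (A (fst q))"
      using A(1) by (intro emeasure_mono) (auto simp: B_def split: prod.split)
    then show ?thesis using A(3)[of "fst q"] by (auto simp: less_top[symmetric] top_unique)
  qed
  define J where "J = {(k::nat, js::int list). length js = n \<and> distinct js}"
  have B_disj: "disjoint_family_on (B q) {..<n}" if "q \<in> J" for q
    using that by (auto simp: B_def J_def disjoint_family_on_def nth_eq_iff_index_eq)
  have cover: "S \<subseteq> (\<Union>q\<in>J. S \<inter> Pi\<^sub>E {..<n} (B q))"
  proof
    fix x assume x: "x \<in> S"
    then have xs: "x \<in> (\<Pi>\<^sub>E i\<in>{..<n}. space M)"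
      using sets.sets_into_space[OF S(1)] by (auto simp: space_PiM)
    have "eventually (\<lambda>k. x i \<in> A k) sequentially" if "i < n" for i
    proof -
      have "x i \<in> (\<Union>k. A k)" using xs that A(2) by (auto simp: PiE_iff)
      then obtain k0 where "x i \<in> A k0" by auto
      then show ?thesis
        using incseqD[OF A(4)] by (intro eventually_sequentiallyI[of k0]) auto
    qed
    then have ev1: "eventually (\<lambda>k. \<forall>i\<in>{..<n}. x i \<in> A k) sequentially"
      by (intro eventually_ball_finite) auto
    have "eventually (\<lambda>k. \<lfloor>real k * f (x i)\<rfloor> \<noteq> \<lfloor>real k * f (x j)\<rfloor>) sequentially"
      if "i < n" "j < n" "i \<noteq> j" for i j
    proof -
      have "f (x i) \<noteq> f (x j)" using inj[OF x] that by (auto simp: inj_on_def)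
      then have d: "\<bar>f (x i) - f (x j)\<bar> > 0" by simp
      obtain k0 :: nat where k0: "1 / \<bar>f (x i) - f (x j)\<bar> < real k0" using reals_Archimedean2 by blast
      show ?thesis
      proof (rule eventually_sequentiallyI[of k0])
        fix k assume "k0 \<le> k"
        then have "1 / \<bar>f (x i) - f (x j)\<bar> < real k" using k0 by linarith
        then have "1 < \<bar>real k * (f (x i) - f (x j))\<bar>"
          using d by (simp add: abs_mult pos_divide_less_eq)
        then have "1 < \<bar>real k * f (x i) - real k * f (x j)\<bar>" by (simp add: right_diff_distrib)
        then show "\<lfloor>real k * f (x i)\<rfloor> \<noteq> \<lfloor>real k * f (x j)\<rfloor>" by linarith
      qed
    qed
    then have "eventually (\<lambda>k. \<forall>i\<in>{..<n}. \<forall>j\<in>{..<n} - {i}. \<lfloor>real k * f (x i)\<rfloor> \<noteq> \<lfloor>real k * f (x j)\<rfloor>) sequentially"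
      by (intro eventually_ball_finite ballI) auto
    with ev1 have "eventually (\<lambda>k. (\<forall>i\<in>{..<n}. x i \<in> A k) \<and>
        (\<forall>i\<in>{..<n}. \<forall>j\<in>{..<n} - {i}. \<lfloor>real k * f (x i)\<rfloor> \<noteq> \<lfloor>real k * f (x j)\<rfloor>)) sequentially"
      by (rule eventually_conj)
    then obtain k where k: "\<forall>i\<in>{..<n}. x i \<in> A k"
        "\<forall>i\<in>{..<n}. \<forall>j\<in>{..<n} - {i}. \<lfloor>real k * f (x i)\<rfloor> \<noteq> \<lfloor>real k * f (x j)\<rfloor>"
      using eventually_happens'[OF sequentially_bot] by blast
    define js where "js = map (\<lambda>i. \<lfloor>real k * f (x i)\<rfloor>) [0..<n]"
    have "inj_on (\<lambda>i. \<lfloor>real k * f (x i)\<rfloor>) {..<n}" using k(2) by (auto simp: inj_on_def)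
    then have "(k, js) \<in> J" by (simp add: J_def js_def distinct_map lessThan_atLeast0)
    moreover have "x \<in> Pi\<^sub>E {..<n} (B (k, js))"
      using xs k(1) by (auto simp: B_def js_def PiE_iff)
    ultimately show "x \<in> (\<Union>q\<in>J. S \<inter> Pi\<^sub>E {..<n} (B q))" using x by blast
  qed
  have "\<exists>q\<in>J. emeasure (\<Pi>\<^sub>M i\<in>{..<n}. M) (S \<inter> Pi\<^sub>E {..<n} (B q)) \<noteq> 0"
  proof (rule ccontr)
    assume "\<not> ?thesis"
    moreover have "S \<inter> Pi\<^sub>E {..<n} (B q) \<in> sets (\<Pi>\<^sub>M i\<in>{..<n}. M)" for q
      using S(1) B_sets by (intro sets.Int sets_PiM_I_finite) auto
    ultimately have "(\<Union>q\<in>J. S \<inter> Pi\<^sub>E {..<n} (B q)) \<in> null_sets (\<Pi>\<^sub>M i\<in>{..<n}. M)"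
      by (intro null_sets_UN') auto
    from null_sets_subset[OF this S(1) cover] show False using S(2) by auto
  qed
  then obtain q where "q \<in> J" "emeasure (\<Pi>\<^sub>M i\<in>{..<n}. M) (S \<inter> Pi\<^sub>E {..<n} (B q)) \<noteq> 0" by blast
  then show ?thesis
    using B_disj B_sets B_fin by (intro exI[of _ "B q"]) (auto simp: zero_less_iff_neq_zero)
qed

section \<open>Translations of Lebesgue measure\<close>

lemma emeasure_lborel_translate:
  fixes D :: "'a::euclidean_space set"
  assumes "D \<in> sets borel"
  shows "emeasure lborel ((\<lambda>x. x + c) ` D) = emeasure lborel D"
proof -
  have eq: "(\<lambda>x. x + c) ` D = (+) (- c) -` D" by (auto intro!: image_eqI)
  have "emeasure lborel D = emeasure (distr lborel borel ((+) (- c))) D"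
    by (simp only: lborel_distr_plus)
  also have "\<dots> = emeasure lborel ((+) (- c) -` D)"
    using assms by (subst emeasure_distr) auto
  finally show ?thesis by (simp only: eq)
qed

lemma AE_lborel_translate:
  fixes c :: "'a::euclidean_space"
  assumes "AE x in lborel. Q x"
  shows "AE x in lborel. Q (x + c)"
proof -
  have "AE x in distr lborel borel ((+) c). Q x" using assms by (simp only: lborel_distr_plus)
  then have "AE x in lborel. Q (c + x)" by (rule AE_distrD[rotated]) simp
  then show ?thesis by (simp add: add.commute)
qed

lemma nn_integral_lborel_shift:
  fixes x :: "'a::euclidean_space"
  assumes "f \<in> borel_measurable lborel"
  shows "(\<integral>\<^sup>+y. f y \<partial>lborel) = (\<integral>\<^sup>+v. f (x + v) \<partial>lborel)"
proof -
  have "(\<integral>\<^sup>+y. f y \<partial>lborel) = (\<integral>\<^sup>+y. f y \<partial>(distr lborel borel ((+) x)))"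
    by (simp only: lborel_distr_plus)
  also have "\<dots> = (\<integral>\<^sup>+v. f (x + v) \<partial>lborel)"
    using assms by (subst nn_integral_distr) auto
  finally show ?thesis .
qed

text \<open>Sufficiently many translates of \<open>D\<close> inside a bounded region cannot be disjoint. The translates are taken by
the multiples \<open>j / N!\<close> of \<open>v\<close> with \<open>0 \<le> j \<le> N\<close>, because the difference of two distinct
factors is \<open>\<plusminus> 1 / m\<close> for some \<open>m > 0\<close>.\<close>

lemma pigeonhole_translates:
  fixes D :: "'a::euclidean_space set" and v :: 'a
  assumes D: "D \<in> sets borel" "emeasure lborel D > 0" "bounded D"
  shows "\<exists>m>0. \<exists>a\<in>D. \<exists>b\<in>D. b - a = (1 / real m) *\<^sub>R v"
proof (rule ccontr)
  assume neg: "\<not> ?thesis"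
  obtain r where r: "\<And>x. x \<in> D \<Longrightarrow> norm x \<le> r" using D(3) by (auto simp: bounded_iff)
  define K where "K = cball (0::'a) (r + norm v)"
  have K: "emeasure lborel K < \<infinity>" unfolding K_def by (rule emeasure_lborel_cball_finite)
  define S where "S N j = (\<lambda>x. x + (real j / fact N) *\<^sub>R v) ` D" for N j :: nat
  have S_meas: "S N j \<in> sets borel" for N j
  proof -
    have "S N j = (\<lambda>x. x - (real j / fact N) *\<^sub>R v) -` D \<inter> space borel"
      unfolding S_def by (auto intro!: image_eqI)
    also have "\<dots> \<in> sets borel" using D(1) by (intro measurable_sets) auto
    finally show ?thesis .
  qed
  have disj: "disjoint_family_on (S N) {..N}" for N
    unfolding disjoint_family_on_def
  proof (intro ballI impI)
    have *: "S N i \<inter> S N j = {}" if ij: "j < i" "i \<le> N" for i j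
    proof (rule ccontr)
      assume "S N i \<inter> S N j \<noteq> {}"
      then obtain a b where ab: "a \<in> D" "b \<in> D"
        and "a + (real i / fact N) *\<^sub>R v = b + (real j / fact N) *\<^sub>R v"
        by (auto simp: S_def)
      then have "b - a = (real i / fact N) *\<^sub>R v - (real j / fact N) *\<^sub>R v"
        by (simp add: algebra_simps)
      also have "\<dots> = (real (i - j) / fact N) *\<^sub>R v"
        using ij by (simp add: scaleR_diff_left[symmetric] diff_divide_distrib of_nat_diff)
      finally have ba: "b - a = (real (i - j) / fact N) *\<^sub>R v" .
      have "i - j dvd fact N" using ij by (intro dvd_fact) auto
      then obtain m where m: "fact N = (i - j) * m" by auto
      then have "m > 0" using fact_gt_zero[of N, where 'a=nat] by (cases m) auto
      have N: "(fact N :: real) = real (i - j) * real m"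
        by (metis m of_nat_fact of_nat_mult)
      have "real (i - j) \<noteq> 0" using ij by simp
      then have "real (i - j) / fact N = 1 / real m" unfolding N by (simp del: of_nat_diff)
      with ba ab \<open>m > 0\<close> neg show False by metis
    qed
    fix i j assume "i \<in> {..N}" "j \<in> {..N}" "i \<noteq> j"
    then show "S N i \<inter> S N j = {}" using *[of j i] *[of i j] by (cases "i < j") auto
  qed
  have le: "of_nat (Suc N) * emeasure lborel D \<le> emeasure lborel K" for N
  proof -
    have sub: "S N j \<subseteq> K" if "j \<le> N" for j
    proof
      fix y assume "y \<in> S N j"
      then obtain x where x: "x \<in> D" "y = x + (real j / fact N) *\<^sub>R v" by (auto simp: S_def)
      have "real j \<le> fact N" using that fact_ge_self[of N] by (metis of_nat_fact of_nat_le_iff order_trans)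
      then have "\<bar>real j / fact N\<bar> \<le> 1" by simp
      then have "norm ((real j / fact N) *\<^sub>R v) \<le> norm v"
        by (metis mult_left_le_one_le norm_ge_zero norm_scaleR abs_ge_zero)
      then show "y \<in> K" unfolding K_def using x r[of x] norm_triangle_ineq[of x "(real j / fact N) *\<^sub>R v"]
        by auto
    qed
    have "of_nat (Suc N) * emeasure lborel D = (\<Sum>j\<le>N. emeasure lborel (S N j))"
      unfolding S_def by (simp add: emeasure_lborel_translate[OF D(1)])
    also have "\<dots> = emeasure lborel (\<Union>j\<le>N. S N j)"
      using S_meas disj by (intro sum_emeasure) auto
    also have "\<dots> \<le> emeasure lborel K"
      using sub by (intro emeasure_mono) (auto simp: K_def)
    finally show ?thesis .
  qed
  define e k where "e = measure lborel D" and "k = measure lborel K"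
  have "emeasure lborel D < \<infinity>"
    using emeasure_bounded_finite[OF D(3)] by simp
  then have e: "emeasure lborel D = ennreal e" by (simp add: e_def emeasure_eq_ennreal_measure)
  have k: "emeasure lborel K = ennreal k" using K by (simp add: k_def emeasure_eq_ennreal_measure)
  have "e > 0" using D(2) e by auto
  obtain N :: nat where "k / e < real N" using reals_Archimedean2 by blast
  then have N: "k < real N * e" using \<open>e > 0\<close> by (simp add: field_simps)
  have "of_nat (Suc N) * ennreal e = ennreal (real (Suc N) * e)"
    using \<open>e > 0\<close> by (simp only: ennreal_of_nat_eq_real_of_nat) (simp add: ennreal_mult)
  with le[of N] have "ennreal (real (Suc N) * e) \<le> ennreal k" by (simp only: e k)
  moreover have "0 \<le> k" by (simp add: k_def)
  ultimately have "real (Suc N) * e \<le> k" by simp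
  with N \<open>e > 0\<close> show False by (simp add: algebra_simps)
qed

text \<open>The vectors under which \<open>G\<close> is invariant up to null sets form a group, which contains all
differences of elements of \<open>D\<close>. By \<open>pigeonhole_translates\<close> this group contains a fraction \<open>v / m\<close> of
each vector \<open>v\<close>, hence \<open>v\<close> itself. By Fubini, there is a point \<open>x\<close> such that almost every translate \<open>x + v\<close> belongs to
\<open>G\<close> if and only if \<open>x\<close> does.\<close>

lemma translation_invariant_imp_trivial:
  fixes D :: "'a::euclidean_space set"
  assumes G: "G \<in> sets borel" and D: "D \<in> sets borel" "emeasure lborel D > 0"
    and inv: "\<And>u v. u \<in> D \<Longrightarrow> v \<in> D \<Longrightarrow> AE x in lborel. x + u \<in> G \<longleftrightarrow> x + v \<in> G"
  shows "(AE x in lborel. x \<in> G) \<or> (AE x in lborel. x \<notin> G)"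
proof -
  have "\<exists>k::nat. emeasure lborel (D \<inter> cball 0 (real k)) > 0"
  proof (rule ccontr)
    assume "\<not> ?thesis"
    then have "emeasure lborel (\<Union>k::nat. D \<inter> cball 0 (real k)) = 0"
      using D(1) by (intro emeasure_UN_eq_0) auto
    also have "(\<Union>k::nat. D \<inter> cball 0 (real k)) = D"
      using real_arch_simple by auto
    finally show False using D(2) by simp
  qed
  then obtain k :: nat where k: "emeasure lborel (D \<inter> cball 0 (real k)) > 0" ..
  have shift: "AE x in lborel. x \<in> G \<longleftrightarrow> x + v \<in> G" for v
  proof -
    obtain m a b where m: "(m::nat) > 0" "a \<in> D" "b \<in> D" "b - a = (1 / real m) *\<^sub>R v"
      using pigeonhole_translates[of "D \<inter> cball 0 (real k)" v] D(1) k by (auto simp: bounded_Int)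
    define h where "h = (1 / real m) *\<^sub>R v"
    have h: "AE x in lborel. x \<in> G \<longleftrightarrow> x + h \<in> G"
      using AE_lborel_translate[OF inv[OF m(2,3)], of "- a"] m(4)
      by (simp add: h_def[symmetric] algebra_simps)
    have "AE x in lborel. x \<in> G \<longleftrightarrow> x + real l *\<^sub>R h \<in> G" for l :: nat
    proof (induction l)
      case (Suc l)
      from AE_lborel_translate[OF h, of "real l *\<^sub>R h"] Suc show ?case
        by eventually_elim (simp add: algebra_simps)
    qed simp
    from this[of m] show ?thesis using m(1) by (simp add: h_def)
  qed
  have [measurable]: "G \<in> sets borel" by fact
  have "AE v in lborel. AE x in lborel. x \<in> G \<longleftrightarrow> x + v \<in> G"
    using shift by simp
  then have "AE x in lborel. AE v in (lborel :: 'a measure). x \<in> G \<longleftrightarrow> x + v \<in> G"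
    by (subst (asm) lborel_pair.AE_commute) measurable
  then obtain x where x: "AE v in (lborel :: 'a measure). x \<in> G \<longleftrightarrow> x + v \<in> G"
    using eventually_happens'[of "ae_filter (lborel :: 'a measure)"]
    by (auto simp: ae_filter_eq_bot_iff)
  from AE_lborel_translate[OF x, of "- x"] have "AE y in lborel. x \<in> G \<longleftrightarrow> y \<in> G" by simp
  then show ?thesis by (cases "x \<in> G") auto
qed

section \<open>Association\<close>

text \<open>Association bounds the integral of the product from below by the product of the integrals. It is
formulated for integrable functions, so \<open>a\<close> and \<open>b\<close> are truncated at 1, which changes neither
monotonicity nor the set where they vanish. Non-increasing functions are covered by passing to their
negatives, since the signs cancel in the product.\<close>

lemma associated_common_support:
  fixes a b :: "'m \<Rightarrow> ennreal"
  assumes "prob_space Q" and assoc: "associated Q le"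
    and meas: "a \<in> borel_measurable Q" "b \<in> borel_measurable Q"
    and mono: "monotone le (\<le>) a \<and> monotone le (\<le>) b \<or> monotone le (\<ge>) a \<and> monotone le (\<ge>) b"
    and pos: "(\<integral>\<^sup>+r. a r \<partial>Q) > 0" "(\<integral>\<^sup>+r. b r \<partial>Q) > 0"
  shows "\<not> (AE r in Q. a r = 0 \<or> b r = 0)"
proof
  assume ae: "AE r in Q. a r = 0 \<or> b r = 0"
  interpret prob_space Q by fact
  define tr where "tr e = enn2real (min 1 e)" for e :: ennreal
  have tr_bound: "0 \<le> tr e" "tr e \<le> 1" for e
    unfolding tr_def by (auto intro!: enn2real_leI)
  have tr_0: "tr e = 0 \<longleftrightarrow> e = 0" for e
    unfolding tr_def by (auto simp: enn2real_eq_0_iff min_def)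
  have tr_mono: "tr d \<le> tr e" if "d \<le> e" for d e
    unfolding tr_def using that by (intro enn2real_mono) (auto simp: min_def top_unique less_top[symmetric])
  have int: "integrable Q (\<lambda>r. tr (f r))" and int2: "integrable Q (\<lambda>r. tr (f r) * tr (g r))"
    if [measurable]: "f \<in> borel_measurable Q" "g \<in> borel_measurable Q" for f g :: "'m \<Rightarrow> ennreal"
  proof -
    have [measurable]: "(\<lambda>r. tr (f r)) \<in> borel_measurable Q" "(\<lambda>r. tr (g r)) \<in> borel_measurable Q"
      unfolding tr_def by measurable
    show "integrable Q (\<lambda>r. tr (f r))"
      using tr_bound by (intro integrable_const_bound[of _ 1]) auto
    show "integrable Q (\<lambda>r. tr (f r) * tr (g r))"
      using tr_bound by (intro integrable_const_bound[of _ 1]) (auto intro!: mult_le_one)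
  qed
  have int_pos: "(\<integral>r. tr (f r) \<partial>Q) > 0"
    if f: "f \<in> borel_measurable Q" "(\<integral>\<^sup>+r. f r \<partial>Q) > 0" for f :: "'m \<Rightarrow> ennreal"
  proof -
    have "(\<integral>r. tr (f r) \<partial>Q) \<noteq> 0"
    proof
      assume "(\<integral>r. tr (f r) \<partial>Q) = 0"
      then have "AE r in Q. tr (f r) = 0"
        using int[OF f(1) f(1)] tr_bound by (subst (asm) integral_nonneg_eq_0_iff_AE) auto
      then have "(\<integral>\<^sup>+r. f r \<partial>Q) = 0" using f(1) by (simp add: tr_0 nn_integral_0_iff_AE)
      with f(2) show False by simp
    qed
    moreover have "0 \<le> (\<integral>r. tr (f r) \<partial>Q)" using tr_bound by (intro integral_nonneg_AE) auto
    ultimately show ?thesis by simp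
  qed
  have [measurable]: "(\<lambda>r. tr (a r)) \<in> borel_measurable Q" "(\<lambda>r. tr (b r)) \<in> borel_measurable Q"
    using int[OF meas] int[OF meas(2,1)] by (auto dest: borel_measurable_integrable)
  have "(\<integral>r. tr (a r) * tr (b r) \<partial>Q) \<ge> (\<integral>r. tr (a r) \<partial>Q) * (\<integral>r. tr (b r) \<partial>Q)"
    using mono
  proof
    assume "monotone le (\<le>) a \<and> monotone le (\<le>) b"
    then have "monotone le (\<le>) (\<lambda>r. tr (a r))" "monotone le (\<le>) (\<lambda>r. tr (b r))"
      by (auto simp: monotone_def monotone_on_def intro: tr_mono)
    then show ?thesis
      using assoc int[OF meas] int[OF meas(2,1)] int2[OF meas] unfolding associated_def by simp
  next
    assume "monotone le (\<ge>) a \<and> monotone le (\<ge>) b"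
    then have "monotone le (\<le>) (\<lambda>r. - tr (a r))" "monotone le (\<le>) (\<lambda>r. - tr (b r))"
      by (auto simp: monotone_def monotone_on_def intro: tr_mono)
    moreover have "integrable Q (\<lambda>r. - tr (a r))" "integrable Q (\<lambda>r. - tr (b r))"
        "integrable Q (\<lambda>r. (- tr (a r)) * (- tr (b r)))"
      using int[OF meas] int[OF meas(2,1)] int2[OF meas] by simp_all
    ultimately have "(\<integral>r. (- tr (a r)) * (- tr (b r)) \<partial>Q) \<ge> (\<integral>r. - tr (a r) \<partial>Q) * (\<integral>r. - tr (b r) \<partial>Q)"
      using assoc unfolding associated_def by (blast intro: borel_measurable_integrable)
    then show ?thesis by simp
  qed
  moreover have "(\<integral>r. tr (a r) \<partial>Q) * (\<integral>r. tr (b r) \<partial>Q) > 0"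
    using int_pos meas pos by simp
  moreover have "(\<integral>r. tr (a r) * tr (b r) \<partial>Q) = 0"
    using ae by (intro integral_eq_zero_AE) (auto elim!: eventually_mono simp: tr_0)
  ultimately show False by simp
qed

section \<open>Reachability in a random connection model\<close>

text \<open>A finite set of edges is present with the product of the edge probabilities. The bound depends on
\<open>F\<close> only through its cardinality and is therefore uniform over the vertex sets to which it is applied.\<close>

lemma edge_law_all_present_ge:
  assumes F: "finite F" "F \<subseteq> pairs V" and d: "0 \<le> \<delta>" "\<And>e. e \<in> F \<Longrightarrow> \<delta> \<le> edge_prob \<phi> e"
    and le1: "\<And>e. e \<in> F \<Longrightarrow> edge_prob \<phi> e \<le> 1"
    and S: "S \<in> sets (edge_law \<phi> V)"
    and sub: "\<And>c. c \<in> space (edge_law \<phi> V) \<Longrightarrow> (\<And>e. e \<in> F \<Longrightarrow> c e) \<Longrightarrow> c \<in> S"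
  shows "ennreal (\<delta> ^ card F) \<le> emeasure (edge_law \<phi> V) S"
proof -
  define M where "M e = measure_pmf (bernoulli_pmf (edge_prob \<phi> e))" for e
  interpret product_prob_space M "pairs V"
    unfolding product_prob_space_def product_prob_space_axioms_def product_sigma_finite_def M_def
    by (auto intro!: prob_space_measure_pmf prob_space_imp_sigma_finite)
  have L: "edge_law \<phi> V = PiM (pairs V) M" by (simp add: edge_law_def M_def[abs_def])
  have "(\<Prod>e\<in>F. \<delta>) \<le> (\<Prod>e\<in>F. edge_prob \<phi> e)" using d by (intro prod_mono) auto
  then have "ennreal (\<delta> ^ card F) \<le> ennreal (\<Prod>e\<in>F. edge_prob \<phi> e)" by (simp add: ennreal_leI)
  also have "\<dots> = (\<Prod>e\<in>F. ennreal (edge_prob \<phi> e))"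
    using order_trans[OF d] by (intro prod_ennreal[symmetric]) auto
  also have "\<dots> = (\<Prod>e\<in>F. emeasure (M e) {True})"
    using order_trans[OF d] le1 by (intro prod.cong refl) (simp add: M_def emeasure_pmf_single)
  also have "\<dots> = emeasure (PiM (pairs V) M) (prod_emb (pairs V) M F (Pi\<^sub>E F (\<lambda>_. {True})))"
    using F by (intro emeasure_PiM_emb[symmetric]) (auto simp: M_def)
  also have "\<dots> \<le> emeasure (PiM (pairs V) M) S"
  proof (rule emeasure_mono)
    show "prod_emb (pairs V) M F (Pi\<^sub>E F (\<lambda>_. {True})) \<subseteq> S"
    proof
      fix c assume c: "c \<in> prod_emb (pairs V) M F (Pi\<^sub>E F (\<lambda>_. {True}))"
      have "c e" if "e \<in> F" for e
      proof -
        have "restrict c F e \<in> {True}" using c that by (auto simp: prod_emb_def PiE_iff)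
        then show ?thesis using that by simp
      qed
      moreover have "c \<in> space (edge_law \<phi> V)" using c by (simp add: prod_emb_def L space_PiM)
      ultimately show "c \<in> S" by (rule sub[rotated])
    qed
  qed (use S L in simp)
  finally show ?thesis by (simp add: L)
qed

text \<open>A connection function on an arbitrary \<open>\<sigma>\<close>-finite measure space, without positions and marks.\<close>

locale symmetric_kernel = sigma_finite_measure \<mu> for \<mu> :: "'x measure" +
  fixes \<phi> :: "'x \<Rightarrow> 'x \<Rightarrow> real"
  assumes phi_measurable: "(\<lambda>(z, w). \<phi> z w) \<in> borel_measurable (\<mu> \<Otimes>\<^sub>M \<mu>)"
    and phi_sym: "\<phi> z w = \<phi> w z"
    and phi_nonneg: "0 \<le> \<phi> z w" and phi_le_1: "\<phi> z w \<le> 1"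
begin

lemma phi_measurable_compose [measurable (raw)]:
  assumes "f \<in> measurable N \<mu>" "g \<in> measurable N \<mu>"
  shows "(\<lambda>x. \<phi> (f x) (g x)) \<in> borel_measurable N"
  using measurable_compose[OF measurable_Pair[OF assms] phi_measurable] by simp

text \<open>The points that a chain of \<open>n + 1\<close> steps from \<open>z\<close> reaches with positive measure, where \<open>\<phi>\<close> is at
least \<open>\<delta>\<close> at each step. The threshold yields a lower bound for connection probabilities that does
not depend on the positions of the inner points of a chain.\<close>

primrec reach_set :: "real \<Rightarrow> nat \<Rightarrow> 'x \<Rightarrow> 'x set" where
  "reach_set \<delta> 0 z = {w \<in> space \<mu>. \<delta> \<le> \<phi> z w}"
| "reach_set \<delta> (Suc n) z = {w \<in> space \<mu>. 0 < emeasure \<mu> {u \<in> space \<mu>. u \<in> reach_set \<delta> n z \<and> \<delta> \<le> \<phi> u w}}"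

definition reach :: "'x \<Rightarrow> 'x set" where
  "reach z = (\<Union>m n. reach_set (1 / real (Suc m)) n z)"

lemma reach_set_measurable: "Measurable.pred (\<mu> \<Otimes>\<^sub>M \<mu>) (\<lambda>p. snd p \<in> reach_set \<delta> n (fst p))"
proof (induction n)
  case 0
  have "Measurable.pred (\<mu> \<Otimes>\<^sub>M \<mu>) (\<lambda>p. snd p \<in> space \<mu> \<and> \<delta> \<le> \<phi> (fst p) (snd p))" by measurable
  then show ?case by simp
next
  case (Suc n)
  let ?S = "{q \<in> space ((\<mu> \<Otimes>\<^sub>M \<mu>) \<Otimes>\<^sub>M \<mu>). snd q \<in> reach_set \<delta> n (fst (fst q)) \<and> \<delta> \<le> \<phi> (snd q) (snd (fst q))}"
  have "(\<lambda>q. (fst (fst q), snd q)) \<in> measurable ((\<mu> \<Otimes>\<^sub>M \<mu>) \<Otimes>\<^sub>M \<mu>) (\<mu> \<Otimes>\<^sub>M \<mu>)" by measurable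
  from measurable_compose[OF this Suc.IH]
  have [measurable]: "Measurable.pred ((\<mu> \<Otimes>\<^sub>M \<mu>) \<Otimes>\<^sub>M \<mu>) (\<lambda>q. snd q \<in> reach_set \<delta> n (fst (fst q)))" by simp
  have "?S \<in> sets ((\<mu> \<Otimes>\<^sub>M \<mu>) \<Otimes>\<^sub>M \<mu>)" by measurable
  then have [measurable]: "(\<lambda>p. emeasure \<mu> (Pair p -` ?S)) \<in> borel_measurable (\<mu> \<Otimes>\<^sub>M \<mu>)"
    by (rule measurable_emeasure_Pair)
  have "Measurable.pred (\<mu> \<Otimes>\<^sub>M \<mu>) (\<lambda>p. snd p \<in> space \<mu> \<and> 0 < emeasure \<mu> (Pair p -` ?S))" by measurable
  moreover have "(snd p \<in> space \<mu> \<and> 0 < emeasure \<mu> (Pair p -` ?S)) \<longleftrightarrow> snd p \<in> reach_set \<delta> (Suc n) (fst p)"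
    if "p \<in> space (\<mu> \<Otimes>\<^sub>M \<mu>)" for p
  proof -
    have "Pair p -` ?S = {u \<in> space \<mu>. u \<in> reach_set \<delta> n (fst p) \<and> \<delta> \<le> \<phi> u (snd p)}"
      using that by (auto simp: space_pair_measure)
    then show ?thesis by simp
  qed
  ultimately show ?case by (subst measurable_cong[where g="\<lambda>p. snd p \<in> space \<mu> \<and> 0 < emeasure \<mu> (Pair p -` ?S)"]) auto
qed

lemma reach_measurable: "Measurable.pred (\<mu> \<Otimes>\<^sub>M \<mu>) (\<lambda>p. snd p \<in> reach (fst p))"
proof -
  note reach_set_measurable [measurable]
  have "Measurable.pred (\<mu> \<Otimes>\<^sub>M \<mu>) (\<lambda>p. \<exists>m n. snd p \<in> reach_set (1 / real (Suc m)) n (fst p))" by measurable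
  then show ?thesis by (simp add: reach_def)
qed

lemma reach_set_subset_space: "reach_set \<delta> n z \<subseteq> space \<mu>"
  by (cases n) auto

lemma sets_reach_set: "z \<in> space \<mu> \<Longrightarrow> reach_set \<delta> n z \<in> sets \<mu>"
proof -
  assume z: "z \<in> space \<mu>"
  have "(\<lambda>w. (z, w)) \<in> measurable \<mu> (\<mu> \<Otimes>\<^sub>M \<mu>)" using z by measurable
  from measurable_compose[OF this reach_set_measurable]
  have "Measurable.pred \<mu> (\<lambda>w. w \<in> reach_set \<delta> n z)" by simp
  then have "{w \<in> space \<mu>. w \<in> reach_set \<delta> n z} \<in> sets \<mu>" by (rule predE)
  also have "{w \<in> space \<mu>. w \<in> reach_set \<delta> n z} = reach_set \<delta> n z"
    using reach_set_subset_space by blast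
  finally show ?thesis .
qed

lemma sets_reach: "z \<in> space \<mu> \<Longrightarrow> reach z \<in> sets \<mu>"
  unfolding reach_def using sets_reach_set by (intro sets.countable_UN) auto

lemma reach_set_antimono:
  assumes "\<delta>' \<le> \<delta>" "z \<in> space \<mu>" shows "reach_set \<delta> n z \<subseteq> reach_set \<delta>' n z"
proof (induction n)
  case 0 then show ?case using assms by auto
next
  case (Suc n)
  note [measurable] = sets_reach_set[OF assms(2)]
  show ?case
  proof
    fix w assume w: "w \<in> reach_set \<delta> (Suc n) z"
    then have [simp]: "w \<in> space \<mu>" by simp
    have "emeasure \<mu> {u \<in> space \<mu>. u \<in> reach_set \<delta> n z \<and> \<delta> \<le> \<phi> u w}
      \<le> emeasure \<mu> {u \<in> space \<mu>. u \<in> reach_set \<delta>' n z \<and> \<delta>' \<le> \<phi> u w}"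
      using assms Suc by (intro emeasure_mono) auto
    then show "w \<in> reach_set \<delta>' (Suc n) z" using w by auto
  qed
qed

lemma phi_pos_imp_reach:
  assumes "0 < \<phi> z w" "w \<in> space \<mu>" shows "w \<in> reach z"
proof -
  obtain m where "1 / real (Suc m) < \<phi> z w"
    using assms(1) reals_Archimedean by (auto simp: inverse_eq_divide)
  then have "w \<in> reach_set (1 / real (Suc m)) 0 z" using assms by simp
  then show ?thesis unfolding reach_def by blast
qed

text \<open>If many \<open>u\<close> in \<open>reach z\<close> had \<open>\<phi> u w > 0\<close>, then a positive measure of them would share a number of steps and a
threshold, and one further step would take \<open>w\<close> into \<open>reach z\<close>.\<close>

lemma reach_closed:
  assumes z: "z \<in> space \<mu>" and w: "w \<in> space \<mu>" "w \<notin> reach z"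
  shows "AE u in \<mu>. u \<in> reach z \<longrightarrow> \<phi> u w = 0"
proof -
  note [measurable] = sets_reach_set[OF z] w(1)
  have null: "AE u in \<mu>. \<not> (u \<in> reach_set (1 / real (Suc m)) n z \<and> 1 / real (Suc k) \<le> \<phi> u w)" for m n k
  proof -
    let ?\<delta> = "1 / real (Suc (max m k))"
    have d: "?\<delta> \<le> 1 / real (Suc m)" "?\<delta> \<le> 1 / real (Suc k)" by (auto simp: field_simps)
    have "w \<notin> reach_set ?\<delta> (Suc n) z" using w(2) unfolding reach_def by blast
    then have "emeasure \<mu> {u \<in> space \<mu>. u \<in> reach_set ?\<delta> n z \<and> ?\<delta> \<le> \<phi> u w} = 0" using w(1) by simp
    then have "AE u in \<mu>. \<not> (u \<in> reach_set ?\<delta> n z \<and> ?\<delta> \<le> \<phi> u w)"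
      by (subst AE_iff_measurable[OF _ refl]) auto
    then show ?thesis
      using reach_set_antimono[OF d(1) z, of n] d(2) by (auto elim!: eventually_mono)
  qed
  have "AE u in \<mu>. \<forall>m n k. \<not> (u \<in> reach_set (1 / real (Suc m)) n z \<and> 1 / real (Suc k) \<le> \<phi> u w)"
    unfolding AE_all_countable using null by blast
  then show ?thesis
  proof eventually_elim
    case (elim u)
    show ?case
    proof (intro impI, rule ccontr)
      assume u: "u \<in> reach z" and "\<phi> u w \<noteq> 0"
      then have "0 < \<phi> u w" using phi_nonneg[of u w] by simp
      then obtain k where "1 / real (Suc k) < \<phi> u w"
        using reals_Archimedean by (auto simp: inverse_eq_divide)
      then have "1 / real (Suc k) \<le> \<phi> u w" by simp
      moreover from u obtain m n where "u \<in> reach_set (1 / real (Suc m)) n z"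
        unfolding reach_def by blast
      ultimately show False using elim by blast
    qed
  qed
qed

text \<open>Here \<open>x 0, \<dots>, x (n - 1)\<close> are the inner vertices. Distinctness is required of their values under a real function
\<open>f\<close>, because such points can be separated by countably many boxes.\<close>

primrec chain :: "('x \<Rightarrow> real) \<Rightarrow> real \<Rightarrow> 'x \<Rightarrow> (nat \<Rightarrow> 'x) \<Rightarrow> nat \<Rightarrow> 'x \<Rightarrow> bool" where
  "chain f \<delta> z x 0 w \<longleftrightarrow> \<delta> \<le> \<phi> z w"
| "chain f \<delta> z x (Suc n) w \<longleftrightarrow> chain f \<delta> z x n (x n) \<and> \<delta> \<le> \<phi> (x n) w \<and> (\<forall>i<n. f (x i) \<noteq> f (x n))"

lemma chain_fun_upd: "n \<le> k \<Longrightarrow> chain f \<delta> z (x(k := u)) n w \<longleftrightarrow> chain f \<delta> z x n w"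
  by (induction n arbitrary: w) auto

lemma chain_inj: "chain f \<delta> z x n w \<Longrightarrow> inj_on (\<lambda>i. f (x i)) {..<n}"
proof (induction n arbitrary: w)
  case (Suc n)
  then show ?case by (auto simp: lessThan_Suc)
qed simp

text \<open>The index set \<open>I\<close> may exceed \<open>{..<n}\<close>, so that the induction step need not change the product space.\<close>

lemma chain_measurable:
  assumes [measurable]: "f \<in> borel_measurable \<mu>" and z[measurable]: "z \<in> space \<mu>" and "{..<n} \<subseteq> I"
  shows "Measurable.pred ((\<Pi>\<^sub>M i\<in>I. \<mu>) \<Otimes>\<^sub>M \<mu>) (\<lambda>p. chain f \<delta> z (fst p) n (snd p))"
  using assms(3)
proof (induction n)
  case 0
  show ?case unfolding chain.simps by measurable
next
  case (Suc n)
  have n: "n \<in> I" and I: "{..<n} \<subseteq> I" using Suc.prems by auto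
  have m: "(\<lambda>p. fst p i) \<in> measurable ((\<Pi>\<^sub>M i\<in>I. \<mu>) \<Otimes>\<^sub>M \<mu>) \<mu>" if "i \<in> I" for i
    using that by measurable
  note [measurable] = m[OF n]
  have "(\<lambda>p. (fst p, fst p n)) \<in> measurable ((\<Pi>\<^sub>M i\<in>I. \<mu>) \<Otimes>\<^sub>M \<mu>) ((\<Pi>\<^sub>M i\<in>I. \<mu>) \<Otimes>\<^sub>M \<mu>)" by measurable
  from measurable_compose[OF this Suc.IH[OF I]]
  have [measurable]: "Measurable.pred ((\<Pi>\<^sub>M i\<in>I. \<mu>) \<Otimes>\<^sub>M \<mu>) (\<lambda>p. chain f \<delta> z (fst p) n (fst p n))" by simp
  have [measurable]: "Measurable.pred ((\<Pi>\<^sub>M i\<in>I. \<mu>) \<Otimes>\<^sub>M \<mu>) (\<lambda>p. f (fst p i) \<noteq> f (fst p n))" if "i \<in> {..<n}" for i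
  proof -
    have [measurable]: "(\<lambda>p. fst p i) \<in> measurable ((\<Pi>\<^sub>M i\<in>I. \<mu>) \<Otimes>\<^sub>M \<mu>) \<mu>" using that I by (intro m) auto
    show ?thesis by measurable
  qed
  have "Measurable.pred ((\<Pi>\<^sub>M i\<in>I. \<mu>) \<Otimes>\<^sub>M \<mu>) (\<lambda>p. \<forall>i\<in>{..<n}. f (fst p i) \<noteq> f (fst p n))"
    by (intro pred_intros_finite) auto
  then have [measurable]: "Measurable.pred ((\<Pi>\<^sub>M i\<in>I. \<mu>) \<Otimes>\<^sub>M \<mu>) (\<lambda>p. \<forall>i<n. f (fst p i) \<noteq> f (fst p n))"
    by (simp add: Ball_def)
  show ?case unfolding chain.simps by measurable
qed

lemma chain_measurable_section:
  assumes "f \<in> borel_measurable \<mu>" "z \<in> space \<mu>" "w \<in> space \<mu>"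
  shows "Measurable.pred (\<Pi>\<^sub>M i\<in>{..<n}. \<mu>) (\<lambda>x. chain f \<delta> z x n w)"
proof -
  have "(\<lambda>x. (x, w)) \<in> measurable (\<Pi>\<^sub>M i\<in>{..<n}. \<mu>) ((\<Pi>\<^sub>M i\<in>{..<n}. \<mu>) \<Otimes>\<^sub>M \<mu>)"
    using assms(3) by measurable
  from measurable_compose[OF this chain_measurable[OF assms(1,2) order_refl]] show ?thesis by simp
qed

text \<open>By Fubini over the last inner vertex. Distinctness costs nothing, since the level sets of \<open>f\<close> are null.\<close>

lemma reach_set_imp_chain:
  assumes f[measurable]: "f \<in> borel_measurable \<mu>"
    and diffuse: "\<And>c. AE u in \<mu>. f u \<noteq> c"
    and z: "z \<in> space \<mu>" and w: "w \<in> reach_set \<delta> n z"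
  shows "emeasure (\<Pi>\<^sub>M i\<in>{..<n}. \<mu>) {x \<in> space (\<Pi>\<^sub>M i\<in>{..<n}. \<mu>). chain f \<delta> z x n w} > 0"
  using w
proof (induction n arbitrary: w)
  case 0
  interpret P: product_sigma_finite "\<lambda>_::nat. \<mu>" by standard
  show ?case using 0 by (simp add: PiM_empty)
next
  case (Suc n)
  interpret P: product_sigma_finite "\<lambda>_::nat. \<mu>" by standard
  let ?L = "\<lambda>n. \<Pi>\<^sub>M i\<in>{..<n}. \<mu>"
  have w: "w \<in> space \<mu>" using Suc.prems by simp
  note chain_measurable_section[OF f z w, measurable]
  let ?U = "{u \<in> space \<mu>. u \<in> reach_set \<delta> n z \<and> \<delta> \<le> \<phi> u w}"
  define I where "I u = (\<integral>\<^sup>+x. indicator {x \<in> space (?L (Suc n)). chain f \<delta> z x (Suc n) w} (x(n := u)) \<partial>?L n)" for u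
  have S: "{x \<in> space (?L (Suc n)). chain f \<delta> z x (Suc n) w} \<in> sets (?L (Suc n))" by measurable
  have pos: "I u > 0" if u: "u \<in> ?U" for u
  proof -
    have us: "u \<in> space \<mu>" using u by simp
    note chain_measurable_section[OF f z us, measurable]
    \<comment> \<open>For a fixed last vertex \<open>u\<close>, the exceptional set is contained in a rectangle with one null factor.\<close>
    have neq: "AE x in ?L n. f (x i) \<noteq> f u" if i: "i < n" for i
    proof -
      let ?A = "\<lambda>j. if j = i then {y \<in> space \<mu>. f y = f u} else space \<mu>"
      have "emeasure \<mu> {y \<in> space \<mu>. \<not> f y \<noteq> f u} = 0"
        using diffuse[of "f u"] by (intro emeasure_eq_0_AE) simp
      then have "(\<Prod>j<n. emeasure \<mu> (?A j)) = 0" using i by (intro prod_zero) auto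
      moreover have "emeasure (?L n) (Pi\<^sub>E {..<n} ?A) = (\<Prod>j<n. emeasure \<mu> (?A j))"
        by (intro P.emeasure_PiM) auto
      moreover have "Pi\<^sub>E {..<n} ?A \<in> sets (?L n)" by (intro sets_PiM_I_finite) auto
      moreover have "{x \<in> space (?L n). \<not> f (x i) \<noteq> f u} \<subseteq> Pi\<^sub>E {..<n} ?A"
        using i by (auto simp: space_PiM PiE_def Pi_def)
      ultimately show ?thesis by (intro AE_I) auto
    qed
    have "AE x in ?L n. \<forall>i\<in>{..<n}. f (x i) \<noteq> f u" using neq by (intro AE_finite_allI) auto
    then have ae: "AE x in ?L n. \<forall>i<n. f (x i) \<noteq> f u" by (simp add: Ball_def)
    have "0 < emeasure (?L n) {x \<in> space (?L n). chain f \<delta> z x n u}" using Suc.IH u by simp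
    also have "\<dots> = (\<integral>\<^sup>+x. indicator {x \<in> space (?L n). chain f \<delta> z x n u} x \<partial>?L n)"
      by (intro nn_integral_indicator[symmetric]) measurable
    also have "\<dots> = I u"
      unfolding I_def
    proof (rule nn_integral_cong_AE)
      show "AE x in ?L n. indicator {x \<in> space (?L n). chain f \<delta> z x n u} x =
        (indicator {x \<in> space (?L (Suc n)). chain f \<delta> z x (Suc n) w} (x(n := u)) :: ennreal)"
        using ae AE_space
      proof eventually_elim
        case (elim x)
        have "x(n := u) \<in> space (?L (Suc n))"
          using elim(2) us by (auto simp: space_PiM PiE_iff extensional_def)
        then show ?case using elim u by (auto simp: indicator_def chain_fun_upd)
      qed
    qed
    finally show ?thesis .
  qed
  have "emeasure (?L (Suc n)) {x \<in> space (?L (Suc n)). chain f \<delta> z x (Suc n) w} =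
     (\<integral>\<^sup>+x. indicator {x \<in> space (?L (Suc n)). chain f \<delta> z x (Suc n) w} x \<partial>?L (Suc n))"
    using S by simp
  also have "\<dots> = (\<integral>\<^sup>+u. I u \<partial>\<mu>)"
    unfolding lessThan_Suc I_def using S by (intro P.product_nn_integral_insert_rev) (auto simp: lessThan_Suc)
  also have "\<dots> \<noteq> 0"
  proof
    assume 0: "(\<integral>\<^sup>+u. I u \<partial>\<mu>) = 0"
    have "(\<lambda>p. (snd p)(n := fst p)) \<in> measurable (\<mu> \<Otimes>\<^sub>M ?L n) (?L (Suc n))"
      unfolding lessThan_Suc by (rule measurable_fun_upd[where J="{..<n}"]) auto
    from measurable_compose[OF this borel_measurable_indicator[OF S]]
    have "(\<lambda>u. I u) \<in> borel_measurable \<mu>"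
      unfolding I_def
      by (intro sigma_finite_measure.borel_measurable_nn_integral P.sigma_finite finite_lessThan)
        (simp only: split_beta')
    with 0 have "AE u in \<mu>. I u = 0" by (simp add: nn_integral_0_iff_AE)
    then have "AE u in \<mu>. u \<notin> ?U"
    proof eventually_elim
      case (elim u)
      then show ?case using pos[of u] by auto
    qed
    then have "emeasure \<mu> ?U = 0" using emeasure_eq_0_AE[of "\<lambda>u. u \<in> ?U" \<mu>] by simp
    then show False using Suc.prems by simp
  qed
  finally show ?case by (simp add: zero_less_iff_neq_zero)
qed

lemma edge_prob_doubleton: "u \<noteq> v \<Longrightarrow> edge_prob \<phi> {u, v} = \<phi> u v"
  by (rule edge_prob_pair) (rule phi_sym)

text \<open>Vertices of the chain may coincide with \<open>z\<close> or \<open>w\<close>; steps that stay at a vertex need no edge, and repeated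
edges are counted once.\<close>

lemma chain_edges:
  assumes "chain f \<delta> z x n w" "z \<in> V" "w \<in> V" "\<And>i. i < n \<Longrightarrow> x i \<in> V"
  shows "\<exists>F. finite F \<and> F \<subseteq> pairs V \<and> card F \<le> Suc n \<and> (\<forall>e\<in>F. \<delta> \<le> edge_prob \<phi> e) \<and>
    (\<forall>E. F \<subseteq> E \<longrightarrow> connected_in E z w)"
proof -
  have step: "\<exists>F. finite F \<and> F \<subseteq> pairs V \<and> card F \<le> 1 \<and> (\<forall>e\<in>F. \<delta> \<le> edge_prob \<phi> e) \<and>
    (\<forall>E. F \<subseteq> E \<longrightarrow> connected_in E u v)" if "\<delta> \<le> \<phi> u v" "u \<in> V" "v \<in> V" for u v
  proof (cases "u = v")
    case True
    then show ?thesis by (intro exI[of _ "{}"]) (auto simp: connected_in_def)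
  next
    case False
    then show ?thesis using that edge_prob_doubleton[of u v]
      by (intro exI[of _ "{{u, v}}"]) (auto simp: connected_in_def pairs_def)
  qed
  show ?thesis
    using assms(1,3,4)
  proof (induction n arbitrary: w)
    case 0
    then show ?case using step[of z w] assms(2) by simp
  next
    case (Suc n)
    from Suc.prems have *: "chain f \<delta> z x n (x n)" "\<delta> \<le> \<phi> (x n) w" "x n \<in> V" "\<And>i. i < n \<Longrightarrow> x i \<in> V"
      by auto
    obtain F where F: "finite F" "F \<subseteq> pairs V" "card F \<le> Suc n" "\<forall>e\<in>F. \<delta> \<le> edge_prob \<phi> e"
        "\<forall>E. F \<subseteq> E \<longrightarrow> connected_in E z (x n)"
      using Suc.IH[OF *(1,3,4)] by blast
    obtain F' where F': "finite F'" "F' \<subseteq> pairs V" "card F' \<le> 1" "\<forall>e\<in>F'. \<delta> \<le> edge_prob \<phi> e"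
        "\<forall>E. F' \<subseteq> E \<longrightarrow> connected_in E (x n) w"
      using step[OF *(2,3) Suc.prems(2)] by blast
    have "connected_in E z w" if "F \<union> F' \<subseteq> E" for E
    proof -
      have "connected_in E z (x n)" "connected_in E (x n) w" using F(5) F'(5) that by auto
      then show ?thesis unfolding connected_in_def by (rule rtranclp_trans)
    qed
    moreover have "card (F \<union> F') \<le> Suc (Suc n)"
      using card_Un_le[of F F'] F(3) F'(3) by linarith
    ultimately show ?case using F(1,2,4) F'(1,2,4) by (intro exI[of _ "F \<union> F'"]) auto
  qed
qed

text \<open>\<open>rcm_prob\<close> integrates a conditional probability whose measurability in \<open>\<omega>\<close> is not established, so
its positivity on an event would not suffice. It is instead bounded below by a positive constant on an
event of positive probability, on which some chain from \<open>z\<close> to \<open>w\<close> has all its inner vertices in the Poisson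
process.\<close>

lemma reach_imp_connected:
  assumes pp: "poisson_process P \<mu> \<eta>"
    and f: "f \<in> borel_measurable \<mu>" and diffuse: "\<And>c. AE u in \<mu>. f u \<noteq> (c :: real)"
    and z: "z \<in> space \<mu>" and w: "w \<in> reach z"
  shows "rcm_prob P \<phi> (\<lambda>\<omega>. \<eta> \<omega> \<union> {z, w}) (\<lambda>V E. connected_in E z w) > 0"
proof -
  obtain m n where mn: "w \<in> reach_set (1 / real (Suc m)) n z" using w by (auto simp: reach_def)
  define \<delta> where "\<delta> = 1 / real (Suc m)"
  have d: "0 < \<delta>" "\<delta> \<le> 1" by (auto simp: \<delta>_def)
  have w_reach: "w \<in> reach_set \<delta> n z" using mn by (simp add: \<delta>_def)
  then have w_space: "w \<in> space \<mu>" using reach_set_subset_space by blast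
  let ?L = "\<Pi>\<^sub>M i\<in>{..<n}. \<mu>"
  define S where "S = {x \<in> space ?L. chain f \<delta> z x n w}"
  have S: "S \<in> sets ?L" unfolding S_def
    using chain_measurable_section[OF f z w_space] by (rule predE)
  have S_pos: "emeasure ?L S > 0" unfolding S_def
    by (rule reach_set_imp_chain[OF f diffuse z w_reach])
  have S_inj: "inj_on (\<lambda>i. f (x i)) {..<n}" if "x \<in> S" for x
    using that by (auto simp: S_def intro: chain_inj)
  obtain B where B: "disjoint_family_on B {..<n}" "\<And>i. i < n \<Longrightarrow> B i \<in> sets \<mu>"
      "\<And>i. i < n \<Longrightarrow> emeasure \<mu> (B i) < \<infinity>" "emeasure ?L (S \<inter> Pi\<^sub>E {..<n} B) > 0"
    using separating_boxes[OF f S S_pos S_inj] by blast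
  have "S \<inter> Pi\<^sub>E {..<n} B \<in> sets ?L" using S B(2) by (intro sets.Int sets_PiM_I_finite) auto
  then obtain E where E: "E \<in> sets P" "emeasure P E > 0"
      "\<And>\<omega>. \<omega> \<in> E \<Longrightarrow> \<exists>x\<in>S \<inter> Pi\<^sub>E {..<n} B. \<forall>i<n. x i \<in> \<eta> \<omega>"
    using poisson_points_in_product_set[OF pp sigma_finite_measure_axioms B(2,3,1) _ _ B(4)] by auto
  have edge_le1: "edge_prob \<phi> e \<le> 1" if "e \<in> pairs V" for e V
  proof -
    have "card e = 2" using that by (simp add: pairs_def)
    then obtain u v where "e = {u, v}" "u \<noteq> v" unfolding card_2_iff by blast
    then show ?thesis using phi_le_1 by (simp add: edge_prob_doubleton)
  qed
  have bound: "ennreal (\<delta> ^ Suc n) * indicator E \<omega> \<le> emeasure (edge_law \<phi> (\<eta> \<omega> \<union> {z, w}))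
      {c \<in> space (edge_law \<phi> (\<eta> \<omega> \<union> {z, w})). connected_in (edges (\<eta> \<omega> \<union> {z, w}) c) z w}"
    if \<omega>: "\<omega> \<in> space P" for \<omega>
  proof (cases "\<omega> \<in> E")
    case True
    let ?V = "\<eta> \<omega> \<union> {z, w}"
    obtain x where x: "chain f \<delta> z x n w" "\<And>i. i < n \<Longrightarrow> x i \<in> \<eta> \<omega>"
      using E(3)[OF True] by (auto simp: S_def)
    obtain F where F: "finite F" "F \<subseteq> pairs ?V" "card F \<le> Suc n" "\<forall>e\<in>F. \<delta> \<le> edge_prob \<phi> e"
        "\<forall>E. F \<subseteq> E \<longrightarrow> connected_in E z w"
      using chain_edges[OF x(1), of ?V] x(2) by auto
    have "countable ?V" using pp \<omega> by (auto simp: poisson_process_def)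
    have "ennreal (\<delta> ^ Suc n) \<le> ennreal (\<delta> ^ card F)"
      using d F(3) by (intro ennreal_leI power_decreasing) auto
    also have "\<dots> \<le> emeasure (edge_law \<phi> ?V) {c \<in> space (edge_law \<phi> ?V). connected_in (edges ?V c) z w}"
    proof (rule edge_law_all_present_ge[OF F(1,2)])
      show "{c \<in> space (edge_law \<phi> ?V). connected_in (edges ?V c) z w} \<in> sets (edge_law \<phi> ?V)"
        using \<open>countable ?V\<close> by (intro connected_event_measurable) auto
      fix c assume "c \<in> space (edge_law \<phi> ?V)" "\<And>e. e \<in> F \<Longrightarrow> c e"
      moreover from this F(2) have "F \<subseteq> edges ?V c" by (auto simp: edges_def)
      ultimately show "c \<in> {c \<in> space (edge_law \<phi> ?V). connected_in (edges ?V c) z w}"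
        using F(5) by simp
    qed (use F(2,4) d edge_le1 in auto)
    finally show ?thesis using True by simp
  qed simp
  have "0 < ennreal (\<delta> ^ Suc n) * emeasure P E"
    using d E(2) by (simp add: ennreal_zero_less_mult_iff)
  also have "\<dots> = (\<integral>\<^sup>+\<omega>. ennreal (\<delta> ^ Suc n) * indicator E \<omega> \<partial>P)"
    using E(1) by (rule nn_integral_cmult_indicator[symmetric])
  also have "\<dots> \<le> rcm_prob P \<phi> (\<lambda>\<omega>. \<eta> \<omega> \<union> {z, w}) (\<lambda>V E. connected_in E z w)"
    unfolding rcm_prob_def using bound by (intro nn_integral_mono) auto
  finally show ?thesis .
qed

text \<open>Almost surely no point of the process lies in the null set of potential neighbours of \<open>z\<close>, so each of
the countably many possible edges at \<open>z\<close> has probability zero.\<close>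

lemma isolated_not_connected:
  assumes pp: "poisson_process P \<mu> \<eta>" and z: "z \<in> space \<mu>"
    and iso: "AE u in \<mu>. \<phi> z u = 0" and zw: "\<phi> z w = 0" "z \<noteq> w"
  shows "rcm_prob P \<phi> (\<lambda>\<omega>. \<eta> \<omega> \<union> {z, w}) (\<lambda>V E. connected_in E z w) = 0"
proof -
  interpret P: prob_space P using pp by (simp add: poisson_process_def)
  define N where "N = {u \<in> space \<mu>. 0 < \<phi> z u}"
  have N: "N \<in> sets \<mu>" unfolding N_def using z by measurable
  have null: "emeasure \<mu> N = 0"
    unfolding N_def using iso by (intro emeasure_eq_0_AE) (auto elim: eventually_mono)
  have meas: "(\<lambda>\<omega>. num_points (\<eta> \<omega>) N) \<in> borel_measurable P"
    using pp N by (auto simp: poisson_process_def)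
  have "\<forall>k::nat. P.prob {\<omega>\<in>space P. num_points (\<eta> \<omega>) N = of_nat k} =
           measure \<mu> N ^ k / fact k * exp (- measure \<mu> N)"
    using pp N null unfolding poisson_process_def by simp
  from this[rule_format, of 0] have "P.prob {\<omega>\<in>space P. num_points (\<eta> \<omega>) N = 0} = 1"
    using null by (simp add: measure_def)
  then have "AE \<omega> in P. num_points (\<eta> \<omega>) N = 0"
    using meas by (subst (asm) P.prob_Collect_eq_1) auto
  then have "AE \<omega> in P. emeasure (edge_law \<phi> (\<eta> \<omega> \<union> {z, w}))
      {c \<in> space (edge_law \<phi> (\<eta> \<omega> \<union> {z, w})). connected_in (edges (\<eta> \<omega> \<union> {z, w}) c) z w} = 0"
    using AE_space
  proof eventually_elim
    case (elim \<omega>)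
    let ?V = "\<eta> \<omega> \<union> {z, w}"
    have cnt: "countable ?V" and sub: "\<eta> \<omega> \<subseteq> space \<mu>" using pp elim(2) by (auto simp: poisson_process_def)
    have zero: "\<phi> z v = 0" if "v \<in> ?V" "v \<noteq> z" for v
    proof (cases "v = w")
      case False
      with that have "v \<in> \<eta> \<omega>" by auto
      moreover have "\<eta> \<omega> \<inter> N = {}" using elim(1) by (simp add: num_points_eq_0_iff)
      ultimately have "\<not> 0 < \<phi> z v" using sub unfolding N_def by auto
      then show ?thesis using phi_nonneg[of z v] by simp
    qed (simp add: zw)
    have "AE c in edge_law \<phi> ?V. \<not> c {z, v}" if "v \<in> ?V - {z}" for v
    proof -
      have e: "{z, v} \<in> pairs ?V" using that by (auto simp: pairs_def)
      have "edge_prob \<phi> {z, v} = 0"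
        using that zero[of v] edge_prob_doubleton[of z v] by auto
      then have "AE b in measure_pmf (bernoulli_pmf (edge_prob \<phi> {z, v})). \<not> b"
        by (simp add: AE_measure_pmf_iff set_pmf_eq all_bool_eq)
      then show ?thesis unfolding edge_law_def
        by (intro AE_PiM_component[where P="\<lambda>b. \<not> b"] prob_space_measure_pmf e)
    qed
    then have "AE c in edge_law \<phi> ?V. \<forall>v\<in>?V - {z}. \<not> c {z, v}"
      using cnt by (intro AE_ball_countable[THEN iffD2]) auto
    then have "AE c in edge_law \<phi> ?V. \<not> connected_in (edges ?V c) z w"
    proof eventually_elim
      case (elim c)
      show ?case
      proof
        assume "connected_in (edges ?V c) z w"
        then have "(\<lambda>x y. {x, y} \<in> edges ?V c)\<^sup>*\<^sup>* z w" by (simp only: connected_in_def)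
        then obtain v where "{z, v} \<in> edges ?V c"
          using zw(2) by (cases rule: converse_rtranclpE) simp_all
        moreover from this have "v \<in> ?V - {z}" by (auto simp: edges_def pairs_def)
        ultimately show False using elim by (auto simp: edges_def)
      qed
    qed
    then show ?case by (rule emeasure_eq_0_AE)
  qed
  then have "rcm_prob P \<phi> (\<lambda>\<omega>. \<eta> \<omega> \<union> {z, w}) (\<lambda>V E. connected_in E z w) = (\<integral>\<^sup>+\<omega>. 0 \<partial>P)"
    unfolding rcm_prob_def by (rule nn_integral_cong_AE)
  then show ?thesis by simp
qed

end

lemma AE_scale_measure_iff:
  assumes "0 < c" shows "(AE x in scale_measure c M. R x) \<longleftrightarrow> (AE x in M. R x)"
proof -
  have "null_sets (scale_measure c M) = null_sets M"
    using assms by (auto simp: null_sets_def)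
  then show ?thesis by (simp add: eventually_ae_filter space_scale_measure)
qed

lemma sigma_finite_scale_measure:
  assumes "sigma_finite_measure M" "c \<noteq> \<infinity>" shows "sigma_finite_measure (scale_measure c M)"
proof
  obtain A where "countable A" "A \<subseteq> sets M" "\<Union>A = space M" "\<forall>a\<in>A. emeasure M a \<noteq> \<infinity>"
    using sigma_finite_measure.sigma_finite_countable[OF assms(1)] by blast
  then show "\<exists>A. countable A \<and> A \<subseteq> sets (scale_measure c M) \<and> \<Union>A = space (scale_measure c M) \<and>
      (\<forall>a\<in>A. emeasure (scale_measure c M) a \<noteq> \<infinity>)"
    using assms(2) by (intro exI[of _ A]) (auto simp: ennreal_mult_eq_top_iff space_scale_measure)
qed

text \<open>Reachability is to be applied with the intensity measure of the Poisson process, a multiple of \<open>lam Q\<close>.\<close>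

lemma symmetric_kernel_scale_measure:
  assumes "symmetric_kernel \<mu> \<phi>" "c \<noteq> \<infinity>" shows "symmetric_kernel (scale_measure c \<mu>) \<phi>"
proof -
  interpret symmetric_kernel \<mu> \<phi> by fact
  interpret s: sigma_finite_measure "scale_measure c \<mu>"
    by (rule sigma_finite_scale_measure[OF sigma_finite_measure_axioms assms(2)])
  have "sets (scale_measure c \<mu> \<Otimes>\<^sub>M scale_measure c \<mu>) = sets (\<mu> \<Otimes>\<^sub>M \<mu>)"
    by (intro sets_pair_measure_cong) auto
  then show ?thesis
    using phi_measurable phi_sym phi_nonneg phi_le_1
    by unfold_locales (auto cong: measurable_cong_sets)
qed

section \<open>Closed sets in the stationary marked model\<close>

locale marked_kernel =
  fixes Q :: "'m::polish_space measure" and \<phi> :: "'a::euclidean_space \<times> 'm \<Rightarrow> 'a \<times> 'm \<Rightarrow> real"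
  assumes prob_space_Q: "prob_space Q" and sets_Q: "sets Q = sets borel"
    and connection: "connection_function Q \<phi>"
begin

sublocale Q: prob_space Q by (rule prob_space_Q)

sublocale LQ: pair_sigma_finite "lborel :: 'a measure" Q ..

lemma sets_lam [measurable_cong]: "sets (lam Q :: ('a \<times> 'm) measure) = sets (lborel \<Otimes>\<^sub>M Q)"
  by (simp only: lam_def)

lemma space_Q [simp]: "space Q = UNIV"
  using sets_eq_imp_space_eq[OF sets_Q] by simp

lemma space_lam [simp]: "space (lam Q :: ('a \<times> 'm) measure) = UNIV"
  by (simp add: lam_def space_pair_measure)

sublocale lam: symmetric_kernel "lam Q :: ('a \<times> 'm) measure" \<phi>
proof (unfold_locales)
  show "\<exists>A. countable A \<and> A \<subseteq> sets (lam Q) \<and> \<Union>A = space (lam Q) \<and> (\<forall>a\<in>A. emeasure (lam Q :: ('a \<times> 'm) measure) a \<noteq> \<infinity>)"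
    unfolding lam_def by (rule LQ.sigma_finite_countable)
  have "sets (lam Q :: ('a \<times> 'm) measure) = sets (borel \<Otimes>\<^sub>M borel)"
    unfolding sets_lam by (intro sets_pair_measure_cong) (auto simp: sets_Q)
  then have "sets (lam Q \<Otimes>\<^sub>M lam Q :: (('a \<times> 'm) \<times> ('a \<times> 'm)) measure) = sets ((borel \<Otimes>\<^sub>M borel) \<Otimes>\<^sub>M (borel \<Otimes>\<^sub>M borel))"
    by (intro sets_pair_measure_cong)
  then show "(\<lambda>(z, w). \<phi> z w) \<in> borel_measurable (lam Q \<Otimes>\<^sub>M lam Q)"
    using connection unfolding connection_function_def by (simp cong: measurable_cong_sets)
  show "\<phi> z w = \<phi> w z" "0 \<le> \<phi> z w" "\<phi> z w \<le> 1" for z w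
    using connection unfolding connection_function_def by blast+
qed

lemma phi_shift: "\<phi> (x, p) (x + v, q) = \<phi> (0, p) (v, q)"
proof -
  have "\<phi> (x, p) (x + v, q) = \<phi> (0, p) ((x + v) - x, q)"
    using connection unfolding connection_function_def by blast
  then show ?thesis by simp
qed

lemma nn_integral_lam:
  assumes "F \<in> borel_measurable (lam Q)"
  shows "(\<integral>\<^sup>+u. F u \<partial>lam Q) = (\<integral>\<^sup>+r. \<integral>\<^sup>+x. F (x, r) \<partial>(lborel :: 'a measure) \<partial>Q)"
  using LQ.nn_integral_snd[of F] assms by (simp add: lam_def)

lemma d_phi_measurable: "d_phi \<phi> p \<in> borel_measurable Q"
proof -
  have "(\<lambda>q. \<integral>\<^sup>+x. ennreal (\<phi> (0, p) (x, q)) \<partial>lborel) \<in> borel_measurable Q" by measurable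
  then show ?thesis by (simp add: d_phi_def[abs_def])
qed

lemma degree_pos_measurable: "Measurable.pred Q (\<lambda>p. 0 < (\<integral>\<^sup>+q. d_phi \<phi> p q \<partial>Q))"
  unfolding d_phi_def by measurable

lemma nn_integral_phi: "(\<integral>\<^sup>+w. ennreal (\<phi> z w) \<partial>lam Q) = (\<integral>\<^sup>+q. d_phi \<phi> (snd z) q \<partial>Q)"
proof -
  have "(\<integral>\<^sup>+w. ennreal (\<phi> z w) \<partial>lam Q) = (\<integral>\<^sup>+q. \<integral>\<^sup>+y. ennreal (\<phi> z (y, q)) \<partial>lborel \<partial>Q)"
    by (rule nn_integral_lam) measurable
  also have "\<dots> = (\<integral>\<^sup>+q. d_phi \<phi> (snd z) q \<partial>Q)"
  proof (intro nn_integral_cong)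
    fix q
    have "(\<integral>\<^sup>+y. ennreal (\<phi> z (y, q)) \<partial>lborel) = (\<integral>\<^sup>+v. ennreal (\<phi> z (fst z + v, q)) \<partial>lborel)"
      by (rule nn_integral_lborel_shift) measurable
    also have "\<dots> = d_phi \<phi> (snd z) q"
      using phi_shift[of "fst z" "snd z"] by (simp add: d_phi_def)
    finally show "(\<integral>\<^sup>+y. ennreal (\<phi> z (y, q)) \<partial>lborel) = d_phi \<phi> (snd z) q" .
  qed
  finally show ?thesis .
qed

lemma expected_degree_zero_iff: "(\<integral>\<^sup>+q. d_phi \<phi> (snd z) q \<partial>Q) = 0 \<longleftrightarrow> (AE w in lam Q. \<phi> z w = 0)"
proof -
  have "(\<integral>\<^sup>+q. d_phi \<phi> (snd z) q \<partial>Q) = 0 \<longleftrightarrow> (AE w in lam Q. ennreal (\<phi> z w) = 0)"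
    unfolding nn_integral_phi[symmetric] by (rule nn_integral_0_iff_AE) measurable
  also have "\<dots> \<longleftrightarrow> (AE w in lam Q. \<phi> z w = 0)"
  proof -
    have "\<phi> z w \<le> 0 \<longleftrightarrow> \<phi> z w = 0" for w using lam.phi_nonneg[of z w] by linarith
    then show ?thesis by (simp add: ennreal_eq_0_iff)
  qed
  finally show ?thesis .
qed

lemma AE_lam_mark:
  assumes R: "Measurable.pred Q R"
  shows "(AE z in (lam Q :: ('a \<times> 'm) measure). R (snd z)) \<longleftrightarrow> (AE p in Q. R p)"
proof
  assume "AE z in (lam Q :: ('a \<times> 'm) measure). R (snd z)"
  from LQ.AE_pair[OF this[unfolded lam_def]] have "AE x in (lborel :: 'a measure). AE p in Q. R p" by simp
  then show "AE p in Q. R p"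
    using eventually_happens'[of "ae_filter (lborel :: 'a measure)"] by (auto simp: ae_filter_eq_bot_iff)
next
  assume ae: "AE p in Q. R p"
  have "{z \<in> space (lborel \<Otimes>\<^sub>M Q). R (snd z)} \<in> sets ((lborel :: 'a measure) \<Otimes>\<^sub>M Q)"
    using measurable_compose[OF measurable_snd R] by (rule predE)
  then show "AE z in (lam Q :: ('a \<times> 'm) measure). R (snd z)"
    unfolding lam_def by (rule LQ.AE_pair_measure) (simp add: ae)
qed

text \<open>\<open>A\<close> and its complement are separated by \<open>\<phi>\<close>, so membership in \<open>A\<close> agrees at \<open>(x, r)\<close> and \<open>(x + v, s)\<close>
for almost all \<open>r\<close>, \<open>s\<close>, \<open>v\<close>, \<open>x\<close> with \<open>\<phi> (0, r) (v, s) > 0\<close>. For fixed marks with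
\<open>d_phi \<phi> r s > 0\<close>, the section at \<open>s\<close> is thus invariant under all differences of such vectors \<open>v\<close>.\<close>

lemma closed_set_sections:
  assumes A: "A \<in> sets (lam Q)"
    and closed: "\<And>w. w \<notin> A \<Longrightarrow> AE u in lam Q. u \<in> A \<longrightarrow> \<phi> u w = 0"
  shows "AE r in Q. AE s in Q. 0 < d_phi \<phi> r s \<longrightarrow>
    (AE x in lborel. (x, r) \<in> A) \<and> (AE x in lborel. (x, s) \<in> A) \<or>
    (AE x in lborel. (x, r) \<notin> A) \<and> (AE x in lborel. (x, s) \<notin> A)"
proof -
  have [measurable]: "Measurable.pred (lam Q) (\<lambda>w. w \<in> A)" using A by measurable
  interpret LL: pair_sigma_finite "lam Q :: ('a \<times> 'm) measure" "lam Q :: ('a \<times> 'm) measure" ..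
  \<comment> \<open>The indicator of the forbidden pairs: joined with positive probability, but only one of the two points in \<open>A\<close>.\<close>
  define g :: "'a \<times> 'm \<Rightarrow> 'a \<times> 'm \<Rightarrow> ennreal" where
    "g u w = (if 0 < \<phi> u w \<and> (u \<in> A) \<noteq> (w \<in> A) then 1 else 0)" for u w
  have g_meas[measurable (raw)]: "(\<lambda>x. g (f x) (h x)) \<in> borel_measurable N"
    if [measurable]: "f \<in> measurable N (lam Q)" "h \<in> measurable N (lam Q)" for f h and N :: "'z measure"
    unfolding g_def by measurable
  have sections: "(AE x in lborel. (x, r) \<in> A) \<and> (AE x in lborel. (x, s) \<in> A) \<or>
    (AE x in lborel. (x, r) \<notin> A) \<and> (AE x in lborel. (x, s) \<notin> A)"
    if zero: "(\<integral>\<^sup>+v. \<integral>\<^sup>+x. g (x, r) (x + v, s) \<partial>lborel \<partial>lborel) = 0" and pos: "0 < d_phi \<phi> r s"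
    for r s
  proof -
    define D where "D = {v \<in> space lborel. 0 < \<phi> (0, r) (v, s) \<and> (\<integral>\<^sup>+x. g (x, r) (x + v, s) \<partial>lborel) = 0}"
    have D: "D \<in> sets borel" unfolding D_def by measurable
    have aev: "AE v in lborel. (\<integral>\<^sup>+x. g (x, r) (x + v, s) \<partial>lborel) = 0"
      using zero by (subst (asm) nn_integral_0_iff_AE) measurable
    have "emeasure lborel D \<noteq> 0"
    proof
      assume "emeasure lborel D = 0"
      then have "AE v in lborel. v \<notin> D" using D by (intro AE_not_in) auto
      with aev have "AE v in lborel. \<phi> (0, r) (v, s) = 0"
      proof eventually_elim
        case (elim v)
        then show ?case using lam.phi_nonneg[of "(0, r)" "(v, s)"] by (auto simp: D_def)
      qed
      then have "AE v in lborel. ennreal (\<phi> (0, r) (v, s)) = 0" by eventually_elim simp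
      then have "d_phi \<phi> r s = 0" unfolding d_phi_def by (subst nn_integral_0_iff_AE) measurable
      with pos show False by simp
    qed
    then have D_pos: "emeasure lborel D > 0" by (simp add: zero_less_iff_neq_zero)
    define G where "G = {y \<in> space lborel. (y, s) \<in> A}"
    have G: "G \<in> sets borel" unfolding G_def by measurable
    have shift: "AE x in lborel. (x, r) \<in> A \<longleftrightarrow> x + v \<in> G" if "v \<in> D" for v
    proof -
      have "(\<integral>\<^sup>+x. g (x, r) (x + v, s) \<partial>lborel) = 0" and v: "0 < \<phi> (0, r) (v, s)"
        using that by (auto simp: D_def)
      then have "AE x in lborel. g (x, r) (x + v, s) = 0"
        by (subst (asm) nn_integral_0_iff_AE) measurable
      then show ?thesis
        by eventually_elim (use v in \<open>auto simp: g_def phi_shift G_def split: if_splits\<close>)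
    qed
    have inv: "AE x in lborel. x + u \<in> G \<longleftrightarrow> x + v \<in> G" if "u \<in> D" "v \<in> D" for u v
      using shift[OF that(1)] shift[OF that(2)] by eventually_elim simp
    obtain v where v: "v \<in> D" using D_pos by fastforce
    from translation_invariant_imp_trivial[OF G D D_pos inv]
    show ?thesis
    proof
      assume *: "AE x in lborel. x \<in> G"
      from AE_lborel_translate[OF this, of v] shift[OF v] have "AE x in lborel. (x, r) \<in> A"
        by eventually_elim simp
      then show ?thesis using * by (simp add: G_def)
    next
      assume *: "AE x in lborel. x \<notin> G"
      from AE_lborel_translate[OF this, of v] shift[OF v] have "AE x in lborel. (x, r) \<notin> A"
        by eventually_elim simp
      then show ?thesis using * by (simp add: G_def)
    qed
  qed
  have in_out: "AE w in lam Q. AE u in lam Q. u \<in> A \<and> w \<notin> A \<longrightarrow> \<phi> u w = 0"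
  proof (rule AE_I2)
    show "AE u in lam Q. u \<in> A \<and> w \<notin> A \<longrightarrow> \<phi> u w = 0" for w
      using closed[of w] by (cases "w \<in> A") auto
  qed
  then have out_in: "AE u in lam Q. AE w in lam Q. u \<in> A \<and> w \<notin> A \<longrightarrow> \<phi> u w = 0"
    by (subst LL.AE_commute) measurable
  have "AE u in lam Q. AE w in lam Q. g u w = 0"
    using in_out out_in
  proof eventually_elim
    case (elim u)
    from elim show ?case
    proof eventually_elim
      case (elim w)
      then show ?case using lam.phi_sym[of u w] by (auto simp: g_def)
    qed
  qed
  then have "AE u in lam Q. (\<integral>\<^sup>+w. g u w \<partial>lam Q) = 0" by (simp add: nn_integral_0_iff_AE)
  \<comment> \<open>The integral over pairs of points is rearranged so that, for fixed marks \<open>r\<close> and \<open>s\<close>, the integration over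
    the displacement \<open>v = y - x\<close> comes before that over the position \<open>x\<close>.\<close>
  then have "0 = (\<integral>\<^sup>+u. \<integral>\<^sup>+w. g u w \<partial>lam Q \<partial>lam Q)"
    by (subst nn_integral_0_iff_AE[THEN iffD2]) (auto simp: lam.borel_measurable_nn_integral)
  also have "\<dots> = (\<integral>\<^sup>+r. \<integral>\<^sup>+x. \<integral>\<^sup>+w. g (x, r) w \<partial>lam Q \<partial>lborel \<partial>Q)"
    by (rule nn_integral_lam) measurable
  also have "\<dots> = (\<integral>\<^sup>+r. \<integral>\<^sup>+x. \<integral>\<^sup>+s. \<integral>\<^sup>+y. g (x, r) (y, s) \<partial>lborel \<partial>Q \<partial>lborel \<partial>Q)"
    by (intro nn_integral_cong nn_integral_lam) measurable
  also have "\<dots> = (\<integral>\<^sup>+r. \<integral>\<^sup>+s. \<integral>\<^sup>+x. \<integral>\<^sup>+y. g (x, r) (y, s) \<partial>lborel \<partial>lborel \<partial>Q \<partial>Q)"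
    by (intro nn_integral_cong LQ.Fubini'[symmetric]) measurable
  also have "\<dots> = (\<integral>\<^sup>+r. \<integral>\<^sup>+s. \<integral>\<^sup>+x. \<integral>\<^sup>+v. g (x, r) (x + v, s) \<partial>lborel \<partial>lborel \<partial>Q \<partial>Q)"
    by (intro nn_integral_cong nn_integral_lborel_shift) measurable
  also have "\<dots> = (\<integral>\<^sup>+r. \<integral>\<^sup>+s. \<integral>\<^sup>+v. \<integral>\<^sup>+x. g (x, r) (x + v, s) \<partial>lborel \<partial>lborel \<partial>Q \<partial>Q)"
    by (intro nn_integral_cong lborel_pair.Fubini'[symmetric]) measurable
  finally have "(\<integral>\<^sup>+r. \<integral>\<^sup>+s. \<integral>\<^sup>+v. \<integral>\<^sup>+x. g (x, r) (x + v, s) \<partial>lborel \<partial>lborel \<partial>Q \<partial>Q) = 0" by simp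
  then have "AE r in Q. (\<integral>\<^sup>+s. \<integral>\<^sup>+v. \<integral>\<^sup>+x. g (x, r) (x + v, s) \<partial>lborel \<partial>lborel \<partial>Q) = 0"
    by (subst (asm) nn_integral_0_iff_AE) measurable
  then have "AE r in Q. AE s in Q. (\<integral>\<^sup>+v. \<integral>\<^sup>+x. g (x, r) (x + v, s) \<partial>lborel \<partial>lborel) = 0"
    by eventually_elim (subst (asm) nn_integral_0_iff_AE, measurable)
  then show ?thesis
  proof eventually_elim
    case (elim r)
    then show ?case
    proof eventually_elim
      case (elim s)
      then show ?case using sections by blast
    qed
  qed
qed

text \<open>By association, almost any two marks \<open>p\<close> and \<open>q\<close> have a common neighbour \<open>r\<close>, that is
\<open>d_phi \<phi> p r > 0\<close> and \<open>d_phi \<phi> q r > 0\<close>. Then \<open>closed_set_sections\<close> transfers nullness or fullness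
of the section from \<open>p\<close> to \<open>r\<close> and from \<open>r\<close> to \<open>q\<close>.\<close>

lemma closed_set_trivial:
  assumes assoc: "associated Q le"
    and mono: "(\<forall>p. monotone le (\<le>) (d_phi \<phi> p)) \<or> (\<forall>p. monotone le (\<ge>) (d_phi \<phi> p))"
    and deg: "AE p in Q. (\<integral>\<^sup>+q. d_phi \<phi> p q \<partial>Q) > 0"
    and A: "A \<in> sets (lam Q)"
    and closed: "\<And>w. w \<notin> A \<Longrightarrow> AE u in lam Q. u \<in> A \<longrightarrow> \<phi> u w = 0"
  shows "(AE w in lam Q. w \<in> A) \<or> (AE w in lam Q. w \<notin> A)"
proof -
  have [measurable]: "Measurable.pred (lam Q) (\<lambda>w. w \<in> A)" using A by measurable
  define full where "full p \<longleftrightarrow> (AE x in lborel. (x, p) \<in> A)" for p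
  define void where "void p \<longleftrightarrow> (AE x in lborel. (x, p) \<notin> A)" for p
  have not_both: False if "full p" "void p" for p
  proof -
    from that have "AE x in (lborel :: 'a measure). False" unfolding full_def void_def by eventually_elim simp
    then show False using ae_filter_eq_bot_iff[of "lborel :: 'a measure"] by (simp add: trivial_limit_def)
  qed
  define link where "link r s \<longleftrightarrow> (0 < d_phi \<phi> r s \<longrightarrow> full r \<and> full s \<or> void r \<and> void s)" for r s
  define good where "good r \<longleftrightarrow> 0 < (\<integral>\<^sup>+q. d_phi \<phi> r q \<partial>Q) \<and> (AE s in Q. link r s)" for r
  have "AE r in Q. AE s in Q. link r s"
    using closed_set_sections[OF A closed] by (simp add: link_def full_def void_def)
  with deg have good: "AE r in Q. good r" unfolding good_def by eventually_elim simp
  have same: "full p \<and> full q \<or> void p \<and> void q" if "good p" "good q" for p q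
  proof -
    have "\<not> (AE r in Q. d_phi \<phi> p r = 0 \<or> d_phi \<phi> q r = 0)"
      using that mono by (intro associated_common_support[OF prob_space_Q assoc] d_phi_measurable)
        (auto simp: good_def)
    moreover have "AE r in Q. link p r" "AE r in Q. link q r" using that by (auto simp: good_def)
    ultimately obtain r where "link p r" "link q r" "d_phi \<phi> p r \<noteq> 0" "d_phi \<phi> q r \<noteq> 0"
      by (smt (verit, best) eventually_elim2)
    then show ?thesis unfolding link_def using not_both[of r] by (auto simp: zero_less_iff_neq_zero)
  qed
  obtain p where p: "good p"
    using eventually_happens'[OF Q.ae_filter_bot good] by blast
  from good have "AE q in Q. full p \<and> full q \<or> void p \<and> void q"
    by eventually_elim (rule same[OF p])
  then have "(AE q in Q. full q) \<or> (AE q in Q. void q)"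
    using same[OF p p] not_both[of p] by (cases "full p") (auto elim!: eventually_mono)
  then show ?thesis
  proof
    assume "AE q in Q. full q"
    then have "AE x in lborel. AE q in Q. (x, q) \<in> A" unfolding full_def
      by (subst LQ.AE_commute) measurable
    then have "AE w in lborel \<Otimes>\<^sub>M Q. w \<in> A" by (intro LQ.AE_pair_measure) measurable
    then show ?thesis unfolding lam_def by blast
  next
    assume "AE q in Q. void q"
    then have "AE x in lborel. AE q in Q. (x, q) \<notin> A" unfolding void_def
      by (subst LQ.AE_commute) measurable
    then have "AE w in lborel \<Otimes>\<^sub>M Q. w \<notin> A" by (intro LQ.AE_pair_measure) measurable
    then show ?thesis unfolding lam_def by blast
  qed
qed

section \<open>Irreducibility\<close>

text \<open>Hyperplanes are null. So almost any two points differ in one fixed spatial coordinate, which will be the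
separating function of the chains.\<close>

lemma AE_lam_coordinate_neq:
  assumes b: "b \<in> Basis"
  shows "AE u in (lam Q :: ('a \<times> 'm) measure). fst u \<bullet> b \<noteq> c"
proof -
  have "{x :: 'a. x \<bullet> b = c} \<in> null_sets lborel"
    using negligible_standard_hyperplane[OF b, of c]
    by (simp add: negligible_iff_null_sets null_sets_completion_iff)
  then have "AE x in (lborel :: 'a measure). x \<bullet> b \<noteq> c"
    using AE_not_in by fastforce
  moreover have "{u \<in> space ((lborel :: 'a measure) \<Otimes>\<^sub>M Q). fst u \<bullet> b \<noteq> c} \<in> sets (lborel \<Otimes>\<^sub>M Q)"
    by (intro borel_measurable_neq) measurable
  ultimately have "AE u in (lborel :: 'a measure) \<Otimes>\<^sub>M Q. fst u \<bullet> b \<noteq> c"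
    by (intro LQ.AE_pair_measure) simp_all
  then show ?thesis by (simp only: lam_def)
qed

text \<open>A point with expected degree zero would be isolated, hence connected to almost no other point.\<close>

lemma irreducible_imp_degree_pos:
  fixes \<eta> :: "'w \<Rightarrow> ('a \<times> 'm) set"
  assumes t: "t > 0" and pp: "poisson_process P (scale_measure (ennreal t) (lam Q)) \<eta>"
    and irr: "irreducible_rcm P Q \<phi> \<eta>"
  shows "AE p in Q. (\<integral>\<^sup>+q. d_phi \<phi> p q \<partial>Q) > 0"
proof -
  interpret LL: pair_sigma_finite "lam Q :: ('a \<times> 'm) measure" "lam Q :: ('a \<times> 'm) measure" ..
  interpret S: symmetric_kernel "scale_measure (ennreal t) (lam Q :: ('a \<times> 'm) measure)" \<phi>
    by (rule symmetric_kernel_scale_measure) (simp_all add: lam.symmetric_kernel_axioms)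
  let ?p = "\<lambda>z w. rcm_prob P \<phi> (\<lambda>\<omega>. \<eta> \<omega> \<union> {z, w}) (\<lambda>V E. connected_in E z w)"
  obtain b :: 'a where b: "b \<in> Basis" using nonempty_Basis by blast
  have "AE z in lam Q. AE w in lam Q. ?p z w > 0"
    using LL.AE_pair[OF irr[unfolded irreducible_rcm_def]] by simp
  then have "AE z in (lam Q :: ('a \<times> 'm) measure). (\<integral>\<^sup>+q. d_phi \<phi> (snd z) q \<partial>Q) > 0"
  proof eventually_elim
    case (elim z)
    show ?case
    proof (rule ccontr)
      assume "\<not> ?thesis"
      then have iso: "AE w in lam Q. \<phi> z w = 0"
        by (simp add: expected_degree_zero_iff[symmetric] zero_less_iff_neq_zero)
      from elim iso AE_lam_coordinate_neq[OF b, of "fst z \<bullet> b"]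
      have "AE w in (lam Q :: ('a \<times> 'm) measure). False"
      proof eventually_elim
        case (elim w)
        have "?p z w = 0"
          by (rule S.isolated_not_connected[OF pp])
            (use elim iso t in \<open>auto simp: AE_scale_measure_iff space_scale_measure\<close>)
        with elim show ?case by simp
      qed
      then have "AE p in Q. False" using AE_lam_mark[of "\<lambda>_. False"] by simp
      then show False using Q.ae_filter_bot by (simp add: trivial_limit_def)
    qed
  qed
  then show ?thesis
    by (simp only: AE_lam_mark[OF degree_pos_measurable])
qed

text \<open>For almost all \<open>z\<close>, the set of points that \<open>z\<close> reaches is closed, hence null or of full measure,
and it is not null because the expected degree of \<open>z\<close> is positive.\<close>

lemma degree_pos_imp_irreducible:
  fixes \<eta> :: "'w \<Rightarrow> ('a \<times> 'm) set"
  assumes t: "t > 0" and pp: "poisson_process P (scale_measure (ennreal t) (lam Q)) \<eta>"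
    and assoc: "associated Q le"
    and mono: "(\<forall>p. monotone le (\<le>) (d_phi \<phi> p)) \<or> (\<forall>p. monotone le (\<ge>) (d_phi \<phi> p))"
    and deg: "AE p in Q. (\<integral>\<^sup>+q. d_phi \<phi> p q \<partial>Q) > 0"
  shows "irreducible_rcm P Q \<phi> \<eta>"
proof -
  interpret LL: pair_sigma_finite "lam Q :: ('a \<times> 'm) measure" "lam Q :: ('a \<times> 'm) measure" ..
  let ?\<mu> = "scale_measure (ennreal t) (lam Q :: ('a \<times> 'm) measure)"
  interpret S: symmetric_kernel ?\<mu> \<phi>
    by (rule symmetric_kernel_scale_measure) (simp_all add: lam.symmetric_kernel_axioms)
  have AE_mu: "(AE u in ?\<mu>. R u) \<longleftrightarrow> (AE u in lam Q. R u)" for R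
    using t by (intro AE_scale_measure_iff) simp
  have space_mu: "space ?\<mu> = UNIV" by (simp add: space_scale_measure)
  let ?p = "\<lambda>z w. rcm_prob P \<phi> (\<lambda>\<omega>. \<eta> \<omega> \<union> {z, w}) (\<lambda>V E. connected_in E z w)"
  obtain b :: 'a where b: "b \<in> Basis" using nonempty_Basis by blast
  have coord: "(\<lambda>u. fst u \<bullet> b) \<in> borel_measurable ?\<mu>"
  proof -
    have "(\<lambda>u. fst u \<bullet> b) \<in> borel_measurable (lam Q)" by measurable
    then show ?thesis by (simp cong: measurable_cong_sets)
  qed
  have reach_pos: "?p z w > 0" if "w \<in> S.reach z" for z w
    using that by (intro S.reach_imp_connected[OF pp coord])
      (simp_all add: AE_mu AE_lam_coordinate_neq[OF b] space_mu)
  have "AE z in (lam Q :: ('a \<times> 'm) measure). (\<integral>\<^sup>+q. d_phi \<phi> (snd z) q \<partial>Q) > 0"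
    using deg by (simp only: AE_lam_mark[OF degree_pos_measurable])
  then have "AE z in lam Q. AE w in lam Q. w \<in> S.reach z"
  proof eventually_elim
    case (elim z)
    have "S.reach z \<in> sets (lam Q)" using S.sets_reach[of z] by (simp add: space_mu)
    moreover have "AE u in lam Q. u \<in> S.reach z \<longrightarrow> \<phi> u w = 0" if "w \<notin> S.reach z" for w
      using S.reach_closed[of z w] that by (simp add: space_mu AE_mu)
    ultimately have "(AE w in lam Q. w \<in> S.reach z) \<or> (AE w in lam Q. w \<notin> S.reach z)"
      by (rule closed_set_trivial[OF assoc mono deg])
    moreover have "\<not> (AE w in lam Q. w \<notin> S.reach z)"
    proof
      assume "AE w in lam Q. w \<notin> S.reach z"
      then have "AE w in lam Q. \<phi> z w = 0"
      proof eventually_elim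
        case (elim w)
        then show ?case using S.phi_pos_imp_reach[of z w] S.phi_nonneg[of z w] by (force simp: space_mu)
      qed
      with elim show False by (simp add: expected_degree_zero_iff[symmetric])
    qed
    ultimately show ?case by blast
  qed
  moreover have "{p \<in> space (lam Q \<Otimes>\<^sub>M lam Q). snd p \<in> S.reach (fst p)} \<in> sets (lam Q \<Otimes>\<^sub>M lam Q)"
  proof -
    have "sets (?\<mu> \<Otimes>\<^sub>M ?\<mu>) = sets (lam Q \<Otimes>\<^sub>M lam Q)" by (intro sets_pair_measure_cong) auto
    with predE[OF S.reach_measurable] show ?thesis
      by (simp add: space_pair_measure space_mu)
  qed
  ultimately have "AE p in lam Q \<Otimes>\<^sub>M lam Q. snd p \<in> S.reach (fst p)"
    by (intro LL.AE_pair_measure) simp_all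
  then show ?thesis
    unfolding irreducible_rcm_def
  proof eventually_elim
    case (elim p)
    then show ?case using reach_pos[of "snd p" "fst p"] by (simp add: case_prod_beta)
  qed
qed

end

theorem theorem5p12:
  fixes t :: real
    and P :: "'w measure"
    and Q :: "'m::polish_space measure"
    and le :: "'m \<Rightarrow> 'm \<Rightarrow> bool"
    and \<phi> :: "'a::euclidean_space \<times> 'm \<Rightarrow> 'a \<times> 'm \<Rightarrow> real"
    and \<eta> :: "'w \<Rightarrow> ('a \<times> 'm) set"
  assumes "t > 0"
    and "prob_space Q" and "sets Q = sets borel"
    and "connection_function Q \<phi>"
    and "poisson_process P (scale_measure (ennreal t) (lam Q)) \<eta>"
    and "pop_order le"
    and "associated Q le"
    and "(\<forall>p. monotone le (\<le>) (d_phi \<phi> p)) \<or> (\<forall>p. monotone le (\<ge>) (d_phi \<phi> p))"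
  shows "irreducible_rcm P Q \<phi> \<eta> \<longleftrightarrow> (AE p in Q. (\<integral>\<^sup>+ q. d_phi \<phi> p q \<partial>Q) > 0)"
proof -
  interpret marked_kernel Q \<phi> by (rule marked_kernel.intro) fact+
  show ?thesis
    using irreducible_imp_degree_pos[OF assms(1,5)] degree_pos_imp_irreducible[OF assms(1,5,7,8)] by blast
qed

end
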